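(* Let $\bar u=(\bar u_1,\dots,\bar u_{n-1})$, $\bar u_k=kh_1P$, be the uniphase steady solution of the system $$\ddot u_k-\frac1{h_1}\sigma(\Delta u_{k+1})+\frac1{h_1}\sigma(\Delta u_k)=\frac{\varepsilon}{h_1^2}\left(\dot u_{k+1}-2\dot u_k+\dot u_{k-1}\right),\qquad k=1,\dots,n-1,$$ with $u_0=0$, $u_n=P$. If $P\in(\underline{\alpha},\overline{\alpha})$ or $P\in(\underline{\beta},\overline{\beta})$, then $\bar u$ is asymptotically stable if $\varepsilon>0$ and unstable if $\varepsilon<0$.
   Context: $P>0$, $\varepsilon\in\mathbb{R}$, and $n\ge 2$ is an integer with $h_1=1/n$. The unknowns are functions $u_1(t),\dots,u_{n-1}(t)$; $u_0(t)=0$ and $u_n(t)=P$ for all $t$ (so $\dot u_0=\dot u_n=0$), and $\Delta u_k=\frac1{h_1}(u_k-u_{k-1})$ for $k=1,\dots,n$. The function $\sigma:\mathbb{R}\to\mathbb{R}$ is continuously differentiable, $\sigma(0)=0$, $\sigma(\xi)>0$ for $\xi>0$, $\sigma(\xi)<0$ for $\xi<0$. There are numbers $0<\underline{\alpha}<\overline{\alpha}<\underline{\beta}<\overline{\beta}$ such that $\sigma'(\xi)>0$ for $\xi\in(-\infty,\overline{\alpha})\cup(\underline{\beta},\infty)$, $\sigma'(\xi)<0$ for $\xi\in(\overline{\alpha},\underline{\beta})$, $\sigma(\underline{\alpha})=\sigma(\underline{\beta})$ and $\sigma(\overline{\alpha})=\sigma(\overline{\beta})$. Stability is understood for the equivalent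 first-order system in $(u,v)$, $v_k=\dot u_k$, at the equilibrium $(\bar u,0)$. *)

theory Defs
  imports "HOL-Analysis.Analysis"
begin

section \<open>Lyapunov stability for autonomous systems with a finite index set\<close>

text \<open>
  A state is a family of reals; only the coordinates in the finite set \<open>I\<close> are meaningful, so
  vector fields are meant to read only those coordinates. Derivatives at the left end point of
  \<open>{0..}\<close> or \<open>{0..<T}\<close> are one-sided.
\<close>

definition solves_on ::
  "'i set \<Rightarrow> (('i \<Rightarrow> real) \<Rightarrow> 'i \<Rightarrow> real) \<Rightarrow> (real \<Rightarrow> 'i \<Rightarrow> real) \<Rightarrow> real set \<Rightarrow> bool" where
  "solves_on I F x J \<longleftrightarrow>
     (\<forall>t\<in>J. \<forall>i\<in>I. ((\<lambda>s. x s i) has_real_derivative F (x t) i) (at t within J))"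

definition state_dist :: "'i set \<Rightarrow> ('i \<Rightarrow> real) \<Rightarrow> ('i \<Rightarrow> real) \<Rightarrow> real" where
  "state_dist I x y = L2_set (\<lambda>i. x i - y i) I"

definition equilibrium :: "'i set \<Rightarrow> (('i \<Rightarrow> real) \<Rightarrow> 'i \<Rightarrow> real) \<Rightarrow> ('i \<Rightarrow> real) \<Rightarrow> bool" where
  "equilibrium I F z \<longleftrightarrow> (\<forall>i\<in>I. F z i = 0)"

text \<open>
  Existence for all \<open>t \<ge> 0\<close> is part of stability, and the bound is required of every forward
  solution, including those given only on a bounded interval \<open>{0..<T}\<close>.
\<close>

definition lyapunov_stable ::
  "'i set \<Rightarrow> (('i \<Rightarrow> real) \<Rightarrow> 'i \<Rightarrow> real) \<Rightarrow> ('i \<Rightarrow> real) \<Rightarrow> bool" where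
  "lyapunov_stable I F z \<longleftrightarrow>
     (\<forall>e>0. \<exists>d>0. \<forall>y. state_dist I y z < d \<longrightarrow>
        (\<exists>x. solves_on I F x {0..} \<and> (\<forall>i\<in>I. x 0 i = y i)) \<and>
        (\<forall>x T. T > 0 \<longrightarrow> solves_on I F x {0..<T} \<longrightarrow> (\<forall>i\<in>I. x 0 i = y i) \<longrightarrow>
           (\<forall>t\<in>{0..<T}. state_dist I (x t) z < e)))"

definition asymptotically_stable ::
  "'i set \<Rightarrow> (('i \<Rightarrow> real) \<Rightarrow> 'i \<Rightarrow> real) \<Rightarrow> ('i \<Rightarrow> real) \<Rightarrow> bool" where
  "asymptotically_stable I F z \<longleftrightarrow>
     lyapunov_stable I F z \<and>
     (\<exists>d>0. \<forall>x. solves_on I F x {0..} \<longrightarrow> state_dist I (x 0) z < d \<longrightarrow>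
        ((\<lambda>t. state_dist I (x t) z) \<longlongrightarrow> 0) at_top)"

definition unstable ::
  "'i set \<Rightarrow> (('i \<Rightarrow> real) \<Rightarrow> 'i \<Rightarrow> real) \<Rightarrow> ('i \<Rightarrow> real) \<Rightarrow> bool" where
  "unstable I F z \<longleftrightarrow> \<not> lyapunov_stable I F z"


section \<open>The discrete chain as a first-order system\<close>

definition mesh :: "nat \<Rightarrow> real" where
  "mesh n = 1 / real n"

definition strain :: "nat \<Rightarrow> (nat \<Rightarrow> real) \<Rightarrow> nat \<Rightarrow> real" where
  "strain n u k = 1 / mesh n * (u k - u (k - 1))"

definition with_ends :: "nat \<Rightarrow> real \<Rightarrow> (nat \<Rightarrow> real) \<Rightarrow> nat \<Rightarrow> real" where
  "with_ends n b u k = (if k = 0 then 0 else if k = n then b else u k)"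

text \<open>A state \<open>x\<close> encodes \<open>(u, v)\<close> by \<open>u k = x (Inl k)\<close> and \<open>v k = x (Inr k)\<close>.\<close>

definition chain_index :: "nat \<Rightarrow> (nat + nat) set" where
  "chain_index n = {1..n - 1} <+> {1..n - 1}"

definition chain_field ::
  "(real \<Rightarrow> real) \<Rightarrow> real \<Rightarrow> nat \<Rightarrow> real \<Rightarrow> (nat + nat \<Rightarrow> real) \<Rightarrow> nat + nat \<Rightarrow> real" where
  "chain_field \<sigma> \<epsilon> n P x i =
     (let u = with_ends n P (\<lambda>k. x (Inl k));
          v = with_ends n 0 (\<lambda>k. x (Inr k))
      in case i of
           Inl k \<Rightarrow> v k
         | Inr k \<Rightarrow> 1 / mesh n * \<sigma> (strain n u (k + 1)) - 1 / mesh n * \<sigma> (strain n u k)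
                     + \<epsilon> / (mesh n)\<^sup>2 * (v (k + 1) - 2 * v k + v (k - 1)))"

definition uniphase :: "nat \<Rightarrow> real \<Rightarrow> nat + nat \<Rightarrow> real" where
  "uniphase n P = case_sum (\<lambda>k. real k * mesh n * P) (\<lambda>_. 0)"

lemma solves_on_chain_iff:
  assumes ends: "\<And>t. t \<in> J \<Longrightarrow> u t 0 = 0" "\<And>t. t \<in> J \<Longrightarrow> u t n = P"
                "\<And>t. t \<in> J \<Longrightarrow> v t 0 = 0" "\<And>t. t \<in> J \<Longrightarrow> v t n = 0"
  shows "solves_on (chain_index n) (chain_field \<sigma> \<epsilon> n P) (\<lambda>t. case_sum (u t) (v t)) J \<longleftrightarrow>
    (\<forall>t\<in>J. \<forall>k\<in>{1..n - 1}.
       ((\<lambda>s. u s k) has_real_derivative v t k) (at t within J) \<and>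
       (\<exists>a. ((\<lambda>s. v s k) has_real_derivative a) (at t within J) \<and>
            a - 1 / mesh n * \<sigma> (strain n (u t) (k + 1)) + 1 / mesh n * \<sigma> (strain n (u t) k)
              = \<epsilon> / (mesh n)\<^sup>2 * (v t (k + 1) - 2 * v t k + v t (k - 1))))"
proof -
  have eq: "with_ends n P (u t) = u t" "with_ends n 0 (v t) = v t" if "t \<in> J" for t
    using ends[OF that] by (auto simp: with_ends_def fun_eq_iff)
  have solve: "a - b + c = d \<longleftrightarrow> a = b - c + d" for a b c d :: real
    by auto
  show ?thesis
    unfolding solves_on_def chain_index_def
    by (simp add: Plus_def ball_Un chain_field_def eq solve Let_def del: One_nat_def) blast
qed

lemma equilibrium_uniphase:
  assumes "n \<ge> 2"
  shows "equilibrium (chain_index n) (chain_field \<sigma> \<epsilon> n P) (uniphase n P)"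
proof -
  let ?u = "\<lambda>k. real k * mesh n * P"
  have ends: "with_ends n P ?u = ?u" "with_ends n 0 (\<lambda>_. 0) = (\<lambda>_. 0)"
    using assms by (auto simp: with_ends_def fun_eq_iff mesh_def)
  have strain: "strain n ?u k = P" if "k \<ge> 1" for k
    using assms that by (simp add: strain_def mesh_def field_simps of_nat_diff)
  show ?thesis
    unfolding equilibrium_def chain_index_def
    by (auto simp: chain_field_def uniphase_def ends strain Let_def)
qed

end

theory Submission
  imports Defs "HOL-Probability.Discrete_Topology" "HOL-Real_Asymp.Real_Asymp"
begin

text \<open>
  Write \<open>w k\<close> for the displacement of the \<open>k\<close>-th mass from its uniphase position, \<open>v k\<close> for its
  velocity, \<open>s k\<close> and \<open>g k\<close> for the difference quotients of \<open>w\<close> and \<open>v\<close>, and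
  \<open>\<tau> s = \<sigma> (P + s) - \<sigma> P\<close>. Both admissible intervals for \<open>P\<close> lie on increasing branches of the stress, so
  \<open>\<sigma>' P > 0\<close>; near \<open>0\<close> the primitive \<open>W\<close> of \<open>\<tau>\<close> and the product \<open>s * \<tau> s\<close> are then comparable to
  \<open>s\<^sup>2\<close>, and the energy, the sum of all \<open>(v k)\<^sup>2 / 2 + W (s k)\<close>, is a positive definite function of the
  state. Its derivative along solutions is \<open>- \<epsilon> * (\<Sum>k. (g k)\<^sup>2)\<close>: the viscosity drains energy for
  \<open>\<epsilon> > 0\<close> and feeds it for \<open>\<epsilon> < 0\<close>. This has a sign but vanishes at deformed states at rest, so
  it gives no rate. Therefore the energy is corrected by
  \<open>\<delta> * (\<Sum>k. w k * v k + \<epsilon> / 2 * (s k)\<^sup>2)\<close>. The first term contributes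
  \<open>\<delta> * (\<Sum>k. (v k)\<^sup>2 - s k * \<tau> (s k) - \<epsilon> * s k * g k)\<close>, and the second cancels the product
  \<open>\<epsilon> * s k * g k\<close>, which leaves
  \<open>- \<epsilon> * (\<Sum>k. (g k)\<^sup>2) + \<delta> * (\<Sum>k. (v k)\<^sup>2) - \<delta> * (\<Sum>k. s k * \<tau> (s k))\<close>
  (lemma \<open>chain_energy_derivative\<close>). A small \<open>\<delta>\<close> of the same sign as \<open>\<epsilon>\<close> keeps the corrected
  energy \<open>V\<close> comparable to the squared distance from equilibrium, and by the discrete Poincare
  inequality the first sum absorbs the second. Near the equilibrium one gets
  \<open>- sgn \<epsilon> * V' \<ge> c * V\<close> with \<open>c > 0\<close> (lemma \<open>chain_lyapunov_function\<close>).

  For \<open>\<epsilon> > 0\<close> this is exponential decay: a solution that starts close enough to the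
  equilibrium never leaves a given ball and converges
  (\<open>asymptotically_stable_of_quadratic_lyapunov\<close>). For \<open>\<epsilon> < 0\<close> it is exponential growth, which no
  solution other than the equilibrium can sustain inside a ball where \<open>V\<close> is bounded
  (\<open>unstable_of_quadratic_growth\<close>).

  Stability includes the existence of solutions for all \<open>t \<ge> 0\<close>, although the chain field is only
  locally Lipschitz. Clamping the coordinates to a box around the equilibrium makes it globally
  Lipschitz; the solution of the clamped equation exists globally by Banach's fixed point theorem,
  stays in the box by the Lyapunov estimate, and hence solves the original equation.
\<close>

section \<open>Global solutions of Lipschitz differential equations\<close>

text \<open>
  The Picard operator is a contraction on the whole half line in the weighted norm
  \<open>sup (exp (- K * t) * norm (x t - x0))\<close> of Bielecki, where \<open>K\<close> exceeds the Lipschitz constant \<open>L\<close>: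
  integrating \<open>exp (K * s)\<close> gains the factor \<open>1 / K\<close>, so the contraction constant is \<open>L / K\<close>. The weight
  is built into the unknown \<open>g\<close>, with \<open>x t = x0 + exp (K * t) * g t\<close>, so that \<open>g\<close> is a bounded
  continuous function.
\<close>

lemma global_solution_of_lipschitz_ode:
  fixes f :: "'a::banach \<Rightarrow> 'a" and x0 :: 'a
  assumes lip: "L-lipschitz_on UNIV f"
  shows "\<exists>x. x 0 = x0 \<and> (\<forall>t\<ge>0. (x has_vector_derivative f (x t)) (at t within {0..}))"
proof -
  define K where "K = L + 1"
  have "L \<ge> 0" using lip by (rule lipschitz_on_nonneg)
  then have K: "K > 0" "L / K < 1" "L / K \<ge> 0" by (auto simp: K_def)
  have fL: "norm (f a - f b) \<le> L * norm (a - b)" for a b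
    using lipschitz_onD[OF lip, of a b] by (simp add: dist_norm)
  have cf: "continuous_on UNIV f"
    using lipschitz_on_continuous_on[OF lip] .
  define h where "h g s = f (x0 + exp (K * s) *\<^sub>R apply_bcontfun g s)" for g :: "real \<Rightarrow>\<^sub>C 'a" and s
  define G where "G g t = integral {0..t} (h g)" for g :: "real \<Rightarrow>\<^sub>C 'a" and t
  have ch: "continuous_on S (h g)" for g S
    unfolding h_def by (intro continuous_intros continuous_on_compose2[OF cf]) auto
  have dG: "(G g has_vector_derivative h g t) (at t within {0..})" if "t \<ge> 0" for g t
  proof -
    have "at t within {0..t + 1} = at t within {0..}"
      using that by (intro at_within_nhd[of _ "{..<t + 1}"]) auto
    then show ?thesis
      using integral_has_vector_derivative[OF ch[of "{0..t+1}" g], of t] that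
      unfolding G_def by simp
  qed
  have cG: "continuous_on {0..} (G g)" for g
    using dG has_vector_derivative_continuous by (fastforce simp: continuous_on_eq_continuous_within)
  have int_exp: "((\<lambda>s. C * exp (K * s)) has_integral C / K * (exp (K * t) - 1)) {0..t}" if "t \<ge> 0" for C t
  proof -
    have "((\<lambda>s. C * exp (K * s)) has_integral C / K * exp (K * t) - C / K * exp (K * 0)) {0..t}"
      using that K
      by (intro fundamental_theorem_of_calculus)
         (auto intro!: derivative_eq_intros simp: has_real_derivative_iff_has_vector_derivative[symmetric])
    then show ?thesis by (simp add: algebra_simps)
  qed
  have int_bound: "norm (exp (- (K * t)) *\<^sub>R integral {0..t} k) \<le> C / K"
    if t: "t \<ge> 0" and k: "continuous_on {0..t} k" "\<And>s. s \<in> {0..t} \<Longrightarrow> norm (k s) \<le> C * exp (K * s)" and C: "C \<ge> 0"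
    for k :: "real \<Rightarrow> 'a" and C t
  proof -
    have "norm (integral {0..t} k) \<le> integral {0..t} (\<lambda>s. C * exp (K * s))"
      using k int_exp[OF t, of C]
      by (intro integral_norm_bound_integral) (auto intro: integrable_continuous_interval has_integral_integrable)
    also have "\<dots> = C / K * (exp (K * t) - 1)"
      using int_exp[OF t] by (rule integral_unique)
    also have "\<dots> \<le> C / K * exp (K * t)"
      using C K by (intro mult_left_mono) auto
    finally show ?thesis
      by (simp add: exp_minus field_simps)
  qed
  \<comment> \<open>The operator needs arguments on the whole real line, so negative times are sent to \<open>0\<close>.\<close>
  define \<Phi> where "\<Phi> g t = exp (- (K * max 0 t)) *\<^sub>R G g (max 0 t)" for g :: "real \<Rightarrow>\<^sub>C 'a" and t
  have bcont: "\<Phi> g \<in> bcontfun" for g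
  proof (rule bcontfun_normI)
    show "continuous_on UNIV (\<Phi> g)"
      unfolding \<Phi>_def by (intro continuous_intros continuous_on_compose2[OF cG]) auto
    fix t
    define C where "C = norm (f 0) + L * norm x0 + L * norm g"
    have "norm (h g s) \<le> C * exp (K * s)" if "s \<ge> 0" for s
    proof -
      have e: "exp (K * s) \<ge> 1" using that K by simp
      have "norm (h g s) \<le> norm (f 0) + norm (h g s - f 0)"
        using norm_triangle_sub by blast
      also have "norm (h g s - f 0) \<le> L * norm (x0 + exp (K * s) *\<^sub>R apply_bcontfun g s)"
        using fL[of _ 0] unfolding h_def by simp
      also have "\<dots> \<le> L * (norm x0 + exp (K * s) * norm g)"
        using \<open>L \<ge> 0\<close> norm_bounded[of g s]
        by (intro mult_left_mono order.trans[OF norm_triangle_ineq] add_mono) auto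
      finally have "norm (h g s) \<le> (norm (f 0) + L * norm x0) * 1 + L * norm g * exp (K * s)"
        by (simp add: algebra_simps)
      also have "\<dots> \<le> (norm (f 0) + L * norm x0) * exp (K * s) + L * norm g * exp (K * s)"
        using \<open>L \<ge> 0\<close> e by (intro add_mono mult_left_mono) auto
      finally show ?thesis by (simp add: C_def algebra_simps)
    qed
    then show "norm (\<Phi> g t) \<le> C / K"
      unfolding \<Phi>_def G_def using \<open>L \<ge> 0\<close>
      by (intro int_bound ch) (auto simp: C_def)
  qed
  have contr: "dist (Bcontfun (\<Phi> g1)) (Bcontfun (\<Phi> g2)) \<le> L / K * dist g1 g2" for g1 g2
  proof (rule dist_bound)
    fix t :: real
    define u where "u = max 0 t"
    have u: "u \<ge> 0" by (simp add: u_def)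
    have "norm (h g1 s - h g2 s) \<le> L * dist g1 g2 * exp (K * s)" for s
    proof -
      have "norm (h g1 s - h g2 s) \<le> L * norm (exp (K * s) *\<^sub>R (apply_bcontfun g1 s - apply_bcontfun g2 s))"
        using fL[of "x0 + exp (K * s) *\<^sub>R apply_bcontfun g1 s" "x0 + exp (K * s) *\<^sub>R apply_bcontfun g2 s"]
        unfolding h_def by (simp add: algebra_simps)
      also have "\<dots> = L * (exp (K * s) * dist (apply_bcontfun g1 s) (apply_bcontfun g2 s))"
        by (simp add: dist_norm)
      also have "\<dots> \<le> L * (exp (K * s) * dist g1 g2)"
        using \<open>L \<ge> 0\<close> by (intro mult_left_mono dist_bounded) auto
      finally show ?thesis by (simp add: algebra_simps)
    qed
    then have "norm (exp (- (K * u)) *\<^sub>R integral {0..u} (\<lambda>s. h g1 s - h g2 s)) \<le> L * dist g1 g2 / K"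
      using u \<open>L \<ge> 0\<close> by (intro int_bound continuous_intros ch) auto
    moreover have "integral {0..u} (\<lambda>s. h g1 s - h g2 s) = G g1 u - G g2 u"
      unfolding G_def by (intro integral_diff integrable_continuous_interval ch)
    ultimately show "dist (apply_bcontfun (Bcontfun (\<Phi> g1)) t) (apply_bcontfun (Bcontfun (\<Phi> g2)) t) \<le> L / K * dist g1 g2"
      using bcont by (simp add: Bcontfun_inverse \<Phi>_def dist_norm u_def[symmetric] scaleR_diff_right)
  qed
  obtain g where g: "Bcontfun (\<Phi> g) = g"
    using banach_fix_type[of "L / K" "\<lambda>g. Bcontfun (\<Phi> g)"] K contr by auto
  have fix_eq: "apply_bcontfun g t = exp (- (K * t)) *\<^sub>R G g t" if "t \<ge> 0" for t
    using Bcontfun_inverse[OF bcont, of g] that by (simp add: g \<Phi>_def max_def)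
  have h: "h g t = f (x0 + G g t)" if "t \<ge> 0" for t
    unfolding h_def by (simp add: fix_eq[OF that] exp_minus)
  have "G g 0 = 0" by (simp add: G_def)
  moreover have "((\<lambda>t. x0 + G g t) has_vector_derivative f (x0 + G g t)) (at t within {0..})" if "t \<ge> 0" for t
    using dG[OF that, of g] h[OF that] by (auto intro!: derivative_eq_intros)
  ultimately show ?thesis
    by (intro exI[of _ "\<lambda>t. x0 + G g t"]) auto
qed

section \<open>States with finitely many coordinates\<close>

lemma state_dist_le_sum: "state_dist I x y \<le> (\<Sum>i\<in>I. \<bar>x i - y i\<bar>)"
  unfolding state_dist_def by (rule L2_set_le_sum_abs)

lemma abs_coord_le_state_dist:
  assumes "finite I" "i \<in> I"
  shows "\<bar>x i - y i\<bar> \<le> state_dist I x y"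
proof -
  have "\<bar>x i - y i\<bar> \<le> L2_set (\<lambda>i. \<bar>x i - y i\<bar>) I"
    using assms by (rule member_le_L2_set)
  then show ?thesis by (simp add: state_dist_def L2_set_def)
qed

lemma state_dist_nonneg: "state_dist I x y \<ge> 0"
  unfolding state_dist_def by (rule L2_set_nonneg)

lemma state_dist_cong:
  assumes "\<And>i. i \<in> I \<Longrightarrow> x i = y i"
  shows "state_dist I x z = state_dist I y z"
  unfolding state_dist_def by (rule L2_set_cong) (auto simp: assms)

lemma state_dist_sq: "(state_dist I x y)\<^sup>2 = (\<Sum>i\<in>I. (x i - y i)\<^sup>2)"
  unfolding state_dist_def L2_set_def by (simp add: sum_nonneg)

lemma continuous_on_state_dist:
  assumes "\<And>i. i \<in> I \<Longrightarrow> continuous_on S (\<lambda>t. x t i)"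
  shows "continuous_on S (\<lambda>t. state_dist I (x t) z)"
  unfolding state_dist_def L2_set_def by (intro continuous_intros assms)

lemma solves_on_subset:
  assumes "solves_on I F x J" "J' \<subseteq> J"
  shows "solves_on I F x J'"
  using assms unfolding solves_on_def by (meson has_field_derivative_subset subsetD)

lemma solves_on_continuous:
  assumes "solves_on I F x J" "i \<in> I"
  shows "continuous_on J (\<lambda>t. x t i)"
  using assms unfolding solves_on_def
  by (intro DERIV_continuous_on) auto

text \<open>
  The number of coordinates is not a type here, so the Banach space in which the equation is solved is
  that of all bounded functions on the index type, which the discrete topology makes continuous;
  the field is extended by \<open>0\<close> outside \<open>I\<close>.
\<close>

instance bcontfun :: (metric_space, banach) banach ..

lemma global_solution_finite_coordinates:
  fixes F :: "('i \<Rightarrow> real) \<Rightarrow> 'i \<Rightarrow> real"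
  assumes fin: "finite I" and "L \<ge> 0"
    and lip: "\<And>x y i. i \<in> I \<Longrightarrow> \<bar>F x i - F y i\<bar> \<le> L * state_dist I x y"
  shows "\<exists>x. solves_on I F x {0..} \<and> (\<forall>i\<in>I. x 0 i = y i)"
proof -
  define ext where "ext x d = (if of_discrete d \<in> I then x (of_discrete d) else 0)"
    for x :: "'i \<Rightarrow> real" and d
  define S where "S x = Bcontfun (ext x)" for x
  define R where "R g i = apply_bcontfun g (discrete i)" for g :: "'i discrete \<Rightarrow>\<^sub>C real" and i
  have ext: "ext x \<in> bcontfun" for x
  proof (rule bcontfun_normI)
    show "continuous_on UNIV (ext x)"
      by (simp add: continuous_on_open_vimage open_discrete)
    show "norm (ext x d) \<le> (\<Sum>i\<in>I. \<bar>x i\<bar>)" for d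
      using fin by (auto simp: ext_def intro!: member_le_sum sum_nonneg)
  qed
  have apply_S: "apply_bcontfun (S x) = ext x" for x
    unfolding S_def by (rule Bcontfun_inverse[OF ext])
  have RS: "R (S x) i = x i" if "i \<in> I" for x i
    using that by (simp add: R_def apply_S ext_def discrete_inverse)
  define f where "f g = S (F (R g))" for g
  have "(L * card I)-lipschitz_on UNIV f"
  proof (rule lipschitz_onI)
    show "dist (f g) (f h) \<le> L * card I * dist g h" for g h
    proof (rule dist_bound)
      fix k
      have "state_dist I (R g) (R h) \<le> (\<Sum>i\<in>I. \<bar>R g i - R h i\<bar>)"
        by (rule state_dist_le_sum)
      also have "\<dots> \<le> (\<Sum>i\<in>I. dist g h)"
        using dist_bounded[of g _ h] by (intro sum_mono) (simp add: R_def dist_real_def)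
      finally have "L * state_dist I (R g) (R h) \<le> L * (card I * dist g h)"
        using \<open>L \<ge> 0\<close> by (intro mult_left_mono) simp_all
      then have "\<bar>F (R g) i - F (R h) i\<bar> \<le> L * (card I * dist g h)" if "i \<in> I" for i
        using lip[OF that, of "R g" "R h"] by linarith
      then show "dist (apply_bcontfun (f g) k) (apply_bcontfun (f h) k) \<le> L * card I * dist g h"
        using \<open>L \<ge> 0\<close> by (simp add: f_def apply_S ext_def dist_real_def mult.assoc)
    qed
  qed (use \<open>L \<ge> 0\<close> in auto)
  from global_solution_of_lipschitz_ode[OF this]
  obtain g where g0: "g 0 = S y"
    and g: "\<And>t. t \<ge> 0 \<Longrightarrow> (g has_vector_derivative f (g t)) (at t within {0..})"
    by blast
  have lin: "bounded_linear (\<lambda>g. R g i)" for i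
    by (rule bounded_linear_intro[where K = 1])
       (auto simp: R_def norm_bounded[where 'b = real, simplified])
  have "solves_on I F (\<lambda>t. R (g t)) {0..}"
    unfolding solves_on_def
  proof (intro ballI)
    fix t :: real and i assume "t \<in> {0..}" "i \<in> I"
    then show "((\<lambda>s. R (g s) i) has_real_derivative F (R (g t)) i) (at t within {0..})"
      using bounded_linear.has_vector_derivative[OF lin g, of t i]
      by (simp add: f_def RS has_real_derivative_iff_has_vector_derivative)
  qed
  moreover have "\<forall>i\<in>I. R (g 0) i = y i"
    by (simp add: g0 RS)
  ultimately have "solves_on I F (\<lambda>t. R (g t)) {0..} \<and> (\<forall>i\<in>I. R (g 0) i = y i)" ..
  then show ?thesis by (rule exI[where x = "\<lambda>t. R (g t)"])
qed

text \<open>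
  Cutting every coordinate off at distance \<open>r\<close> from \<open>z\<close> does not increase distances, hence composing \<open>F\<close>
  with the cut-off turns a Lipschitz bound on the box into a global one without
  changing \<open>F\<close> on the box. The agreement there also covers states that differ from their
  cut-off outside \<open>I\<close>, because the Lipschitz bound makes \<open>F\<close> blind to these coordinates.
\<close>

lemma global_solution_of_clamped_field:
  fixes F :: "('i \<Rightarrow> real) \<Rightarrow> 'i \<Rightarrow> real"
  assumes fin: "finite I" and "L \<ge> 0" "r \<ge> 0"
    and lip: "\<And>x y i. i \<in> I \<Longrightarrow> \<forall>j\<in>I. \<bar>x j - z j\<bar> \<le> r \<Longrightarrow> \<forall>j\<in>I. \<bar>y j - z j\<bar> \<le> r
                \<Longrightarrow> \<bar>F x i - F y i\<bar> \<le> L * state_dist I x y"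
  shows "\<exists>x F'. solves_on I F' x {0..} \<and> (\<forall>i\<in>I. x 0 i = y i) \<and>
           (\<forall>x. \<forall>i\<in>I. (\<forall>j\<in>I. \<bar>x j - z j\<bar> \<le> r) \<longrightarrow> F' x i = F x i)"
proof -
  define cl where "cl x i = max (z i - r) (min (z i + r) (x i))" for x :: "'i \<Rightarrow> real" and i
  have box: "\<bar>cl x i - z i\<bar> \<le> r" for x i
    using \<open>r \<ge> 0\<close> by (auto simp: cl_def abs_le_iff)
  have cl_lip: "\<bar>cl x i - cl y i\<bar> \<le> \<bar>x i - y i\<bar>" for x y i
    unfolding cl_def by (auto simp: max_def min_def)
  have "state_dist I (cl x) (cl y) \<le> state_dist I x y" for x y
    using cl_lip unfolding state_dist_def L2_set_def
    by (intro real_sqrt_le_mono sum_mono) (simp add: abs_le_square_iff)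
  then have "\<bar>F (cl x) i - F (cl y) i\<bar> \<le> L * state_dist I x y" if "i \<in> I" for x y i
    using lip[OF that, of "cl x" "cl y"] box \<open>L \<ge> 0\<close> by (meson mult_left_mono order.trans)
  from global_solution_finite_coordinates[where F = "\<lambda>x. F (cl x)", OF fin \<open>L \<ge> 0\<close> this]
  obtain x where x: "solves_on I (\<lambda>x. F (cl x)) x {0..}" "\<forall>i\<in>I. x 0 i = y i"
    by blast
  have agree: "F (cl x) i = F x i" if "i \<in> I" "\<forall>j\<in>I. \<bar>x j - z j\<bar> \<le> r" for x i
  proof -
    have "\<forall>j\<in>I. cl x j = x j"
      using that(2) by (auto simp: cl_def abs_le_iff)
    then have "state_dist I (cl x) x = 0"
      by (simp add: state_dist_def L2_set_def)
    then show ?thesis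
      using lip[OF that(1), of "cl x" x] box that(2) by simp
  qed
  show ?thesis
  proof (intro exI conjI allI ballI impI)
    show "solves_on I (\<lambda>x. F (cl x)) x {0..}" by (fact x(1))
    show "x 0 i = y i" if "i \<in> I" for i using x(2) that by simp
    show "F (cl x) i = F x i" if "i \<in> I" "\<forall>j\<in>I. \<bar>x j - z j\<bar> \<le> r" for x i
      using that by (rule agree)
  qed
qed

section \<open>Lyapunov criteria with exponential rates\<close>

text \<open>
  The product \<open>v s * exp (c * s)\<close> is nonincreasing. The rate \<open>c\<close> may have any sign; applied to \<open>- v\<close> and
  \<open>- c\<close> this also yields exponential growth.
\<close>

lemma exponential_decay_of_derivative_bound:
  fixes v :: "real \<Rightarrow> real"
  assumes "t \<ge> 0"
    and v: "\<And>s. s \<in> {0..t} \<Longrightarrow>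
              \<exists>D. (v has_real_derivative D) (at s within {0..t}) \<and> D \<le> - c * v s"
  shows "v t \<le> v 0 * exp (- c * t)"
proof -
  have "v t * exp (c * t) \<le> v 0 * exp (c * 0)"
  proof (rule DERIV_nonpos_imp_decreasing_open[OF \<open>t \<ge> 0\<close>])
    show "continuous_on {0..t} (\<lambda>s. v s * exp (c * s))"
    proof (intro continuous_intros)
      show "continuous_on {0..t} v"
        unfolding continuous_on_eq_continuous_within using v DERIV_continuous by blast
    qed
  next
    fix s assume s: "0 < s" "s < t"
    then obtain D where D: "(v has_real_derivative D) (at s within {0..t})" "D \<le> - c * v s"
      using v[of s] by auto
    have "at s within {0..t} = at s"
      using s by (intro at_within_interior) simp
    then have "((\<lambda>s. v s * exp (c * s)) has_real_derivative (D + c * v s) * exp (c * s)) (at s)"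
      using D(1) by (auto intro!: derivative_eq_intros simp: algebra_simps)
    moreover have "(D + c * v s) * exp (c * s) \<le> 0"
      using D(2) by (simp add: mult_le_0_iff)
    ultimately show "\<exists>y. ((\<lambda>s. v s * exp (c * s)) has_real_derivative y) (at s) \<and> y \<le> 0"
      by blast
  qed
  then show ?thesis by (simp add: exp_minus field_simps)
qed

lemma first_hitting_time:
  fixes \<phi> :: "real \<Rightarrow> real"
  assumes cont: "continuous_on {0..t} \<phi>" and "t \<ge> 0" "\<phi> 0 < \<rho>" "\<rho> \<le> \<phi> t"
  shows "\<exists>t1\<in>{0..t}. \<phi> t1 = \<rho> \<and> (\<forall>s\<in>{0..t1}. \<phi> s \<le> \<rho>)"
proof -
  define H where "H = {s \<in> {0..t}. \<phi> s = \<rho>}"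
  have hit: "\<exists>s'\<in>H. s' \<le> s" if "s \<in> {0..t}" "\<rho> \<le> \<phi> s" for s
  proof -
    have "continuous_on {0..s} \<phi>"
      using that(1) by (intro continuous_on_subset[OF cont]) auto
    then have "\<exists>s'\<ge>0. s' \<le> s \<and> \<phi> s' = \<rho>"
      using IVT'[of \<phi> 0 \<rho> s] assms that by auto
    then show ?thesis using that(1) by (auto simp: H_def)
  qed
  have "closed H"
    unfolding H_def by (rule continuous_closed_preimage_constant[OF cont]) simp
  moreover have "bounded H"
    by (rule bounded_subset[of "{0..t}"]) (auto simp: H_def)
  ultimately have "compact H"
    by (simp add: compact_eq_bounded_closed)
  moreover have "H \<noteq> {}"
    using hit[of t] assms by auto
  ultimately obtain t1 where t1: "t1 \<in> H" "\<And>s. s \<in> H \<Longrightarrow> t1 \<le> s"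
    using compact_attains_inf[of H] by auto
  have "\<phi> s \<le> \<rho>" if "s \<in> {0..t1}" for s
  proof (rule ccontr)
    assume "\<not> \<phi> s \<le> \<rho>"
    moreover have "s \<in> {0..t}" using that t1(1) by (auto simp: H_def)
    ultimately obtain s' where "s' \<in> H" "s' \<le> s" using hit[of s] by auto
    with t1(2)[of s'] that have "s = s'" by auto
    with \<open>s' \<in> H\<close> \<open>\<not> \<phi> s \<le> \<rho>\<close> show False by (simp add: H_def)
  qed
  with t1(1) show ?thesis unfolding H_def by blast
qed

text \<open>
  The estimate on \<open>V\<close> is only available while the curve is in the ball of radius \<open>r\<close>. The curve cannot
  leave it: at the first time at which its distance reaches a suitable \<open>\<rho> < r\<close>, the estimate is
  still valid and bounds that distance by \<open>sqrt (b / a)\<close> times the initial distance, which is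
  less than \<open>\<rho>\<close>. The lemma speaks of curves rather than of solutions because it is applied both to
  solutions of a field and to solutions of its clamped version.
\<close>

lemma lyapunov_confinement:
  assumes "a > 0" "a \<le> b" "c \<ge> 0"
    and quad: "\<And>y. state_dist I y z < r \<Longrightarrow>
                 a * (state_dist I y z)\<^sup>2 \<le> V y \<and> V y \<le> b * (state_dist I y z)\<^sup>2"
    and cont: "\<And>i. i \<in> I \<Longrightarrow> continuous_on {0..<T} (\<lambda>t. x t i)"
    and decay: "\<And>t. t \<in> {0..<T} \<Longrightarrow> state_dist I (x t) z < r \<Longrightarrow>
                 \<exists>D. ((\<lambda>s. V (x s)) has_real_derivative D) (at t within {0..<T}) \<and> D \<le> - c * V (x t)"
    and start: "b * (state_dist I (x 0) z)\<^sup>2 < a * r\<^sup>2" and "r > 0"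
    and t: "t \<in> {0..<T}"
  shows "state_dist I (x t) z < r"
    and "a * (state_dist I (x t) z)\<^sup>2 \<le> b * (state_dist I (x 0) z)\<^sup>2 * exp (- c * t)"
proof -
  define \<phi> where "\<phi> t = state_dist I (x t) z" for t
  have \<phi>0: "\<phi> t \<ge> 0" for t by (simp add: \<phi>_def state_dist_nonneg)
  have bound: "a * (\<phi> s)\<^sup>2 \<le> b * (\<phi> 0)\<^sup>2 * exp (- c * s)"
    if s: "s \<in> {0..<T}" "\<forall>u\<in>{0..s}. \<phi> u < r" for s
  proof -
    have "V (x s) \<le> V (x 0) * exp (- c * s)"
    proof (rule exponential_decay_of_derivative_bound)
      fix u assume u: "u \<in> {0..s}"
      with s decay[of u] obtain D where
        D: "((\<lambda>s. V (x s)) has_real_derivative D) (at u within {0..<T})" "D \<le> - c * V (x u)"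
        by (auto simp: \<phi>_def)
      then show "\<exists>D. ((\<lambda>s. V (x s)) has_real_derivative D) (at u within {0..s}) \<and> D \<le> - c * V (x u)"
        using s by (intro exI[of _ D] conjI has_field_derivative_subset[OF D(1)]) auto
    qed (use s in auto)
    also have "\<dots> \<le> b * (\<phi> 0)\<^sup>2 * exp (- c * s)"
      using quad[of "x 0"] s by (intro mult_right_mono) (auto simp: \<phi>_def)
    finally show ?thesis
      using quad[of "x s"] s by (auto simp: \<phi>_def)
  qed
  have "a * (\<phi> 0)\<^sup>2 \<le> b * (\<phi> 0)\<^sup>2"
    using \<open>a \<le> b\<close> by (intro mult_right_mono) auto
  with start have "a * (\<phi> 0)\<^sup>2 < a * r\<^sup>2" by (simp add: \<phi>_def)
  with \<open>a > 0\<close> have "(\<phi> 0)\<^sup>2 < r\<^sup>2" by simp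
  with \<open>r > 0\<close> have "\<phi> 0 < r" by (simp add: power2_less_imp_less)
  define m where "m = max (\<phi> 0) (sqrt (b / a) * \<phi> 0)"
  have "m \<ge> 0" using \<phi>0 by (simp add: m_def le_max_iff_disj)
  have "(sqrt (b / a) * \<phi> 0)\<^sup>2 < r\<^sup>2"
    using start \<open>a > 0\<close> \<open>a \<le> b\<close> by (simp add: power_mult_distrib field_simps \<phi>_def)
  then have "m < r"
    using \<open>r > 0\<close> \<open>\<phi> 0 < r\<close> unfolding m_def by (auto intro: power2_less_imp_less)
  then obtain \<rho> where \<rho>: "m < \<rho>" "\<rho> < r" using dense by blast
  have small: "\<phi> s < \<rho>" if s: "s \<in> {0..<T}" for s
  proof (rule ccontr)
    assume "\<not> \<phi> s < \<rho>"
    moreover have "continuous_on {0..s} \<phi>"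
      unfolding \<phi>_def using s
      by (intro continuous_on_state_dist continuous_on_subset[OF cont]) auto
    ultimately obtain t1 where t1: "t1 \<in> {0..s}" "\<phi> t1 = \<rho>" "\<forall>u\<in>{0..t1}. \<phi> u \<le> \<rho>"
      using first_hitting_time[of s \<phi> \<rho>] s \<rho> by (auto simp: m_def)
    have "a * \<rho>\<^sup>2 \<le> b * (\<phi> 0)\<^sup>2 * exp (- c * t1)"
      using bound[of t1] t1 s \<rho> by force
    also have "\<dots> \<le> b * (\<phi> 0)\<^sup>2 * 1"
      using t1 \<open>c \<ge> 0\<close> \<open>a > 0\<close> \<open>a \<le> b\<close> by (intro mult_left_mono) auto
    also have "\<dots> = a * (sqrt (b / a) * \<phi> 0)\<^sup>2"
      using \<open>a > 0\<close> \<open>a \<le> b\<close> by (simp add: power_mult_distrib)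
    finally have "\<rho>\<^sup>2 \<le> (sqrt (b / a) * \<phi> 0)\<^sup>2" using \<open>a > 0\<close> by simp
    then have "\<rho> \<le> sqrt (b / a) * \<phi> 0"
      by (rule power2_le_imp_le) (use \<phi>0[of 0] \<open>a > 0\<close> \<open>a \<le> b\<close> in simp)
    then show False using \<rho> by (simp add: m_def)
  qed
  then show "state_dist I (x t) z < r"
    using t \<rho> by (force simp: \<phi>_def)
  show "a * (state_dist I (x t) z)\<^sup>2 \<le> b * (state_dist I (x 0) z)\<^sup>2 * exp (- c * t)"
    using bound[of t] small t \<rho> by (force simp: \<phi>_def)
qed

text \<open>
  With \<open>V\<close> between \<open>a\<close> and \<open>b\<close> times the squared distance, starting within \<open>sqrt (a / b) * e\<close> keeps a
  solution within \<open>e\<close>. The Lipschitz bound yields a solution of the clamped field on \<open>{0..}\<close>; being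
  confined as well, it solves the original equation.
\<close>

theorem asymptotically_stable_of_quadratic_lyapunov:
  assumes fin: "finite I" and "L \<ge> 0" and "r > 0" and "a > 0" and "a \<le> b" and "c > 0"
    and lip: "\<And>x y i. i \<in> I \<Longrightarrow> \<forall>j\<in>I. \<bar>x j - z j\<bar> \<le> r \<Longrightarrow> \<forall>j\<in>I. \<bar>y j - z j\<bar> \<le> r
                \<Longrightarrow> \<bar>F x i - F y i\<bar> \<le> L * state_dist I x y"
    and quad: "\<And>y. state_dist I y z < r \<Longrightarrow>
                 a * (state_dist I y z)\<^sup>2 \<le> V y \<and> V y \<le> b * (state_dist I y z)\<^sup>2"
    and decay: "\<And>x J t. state_dist I (x t) z < r \<Longrightarrow>
                 (\<And>i. i \<in> I \<Longrightarrow> ((\<lambda>s. x s i) has_real_derivative F (x t) i) (at t within J)) \<Longrightarrow>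
                 \<exists>D. ((\<lambda>s. V (x s)) has_real_derivative D) (at t within J) \<and> D \<le> - c * V (x t)"
  shows "asymptotically_stable I F z"
proof -
  define q where "q = sqrt (a / b)"
  have q: "q > 0" "b * q\<^sup>2 = a" using \<open>a > 0\<close> \<open>a \<le> b\<close> by (auto simp: q_def)
  have start: "b * (state_dist I y z)\<^sup>2 < a * e\<^sup>2" if "state_dist I y z < q * e" for y e
  proof -
    have "(state_dist I y z)\<^sup>2 < (q * e)\<^sup>2"
      using that by (intro power_strict_mono state_dist_nonneg) auto
    then have "b * (state_dist I y z)\<^sup>2 < b * (q * e)\<^sup>2"
      using \<open>a > 0\<close> \<open>a \<le> b\<close> by simp
    also have "\<dots> = a * e\<^sup>2"
      using q by (simp add: power_mult_distrib mult.assoc[symmetric])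
    finally show ?thesis .
  qed
  \<comment> \<open>Stated for every \<open>F'\<close> that agrees with \<open>F\<close> on the box, so that it covers the clamped field
    as well as \<open>F\<close> itself.\<close>
  have confine: "state_dist I (x t) z < e \<and>
      a * (state_dist I (x t) z)\<^sup>2 \<le> b * (state_dist I (x 0) z)\<^sup>2 * exp (- c * t)"
    if sol: "solves_on I F' x {0..<T}" and t: "t \<in> {0..<T}" and e: "0 < e" "e \<le> r"
      and x0: "state_dist I (x 0) z < q * e"
      and F': "\<And>x i. i \<in> I \<Longrightarrow> \<forall>j\<in>I. \<bar>x j - z j\<bar> \<le> r \<Longrightarrow> F' x i = F x i"
    for F' x T t e
  proof -
    have decay': "\<exists>D. ((\<lambda>s. V (x s)) has_real_derivative D) (at t within {0..<T}) \<and> D \<le> - c * V (x t)"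
      if t: "t \<in> {0..<T}" "state_dist I (x t) z < e" for t
    proof (rule decay)
      have "\<forall>j\<in>I. \<bar>x t j - z j\<bar> \<le> r"
        using abs_coord_le_state_dist[OF fin, of _ "x t" z] t(2) e by force
      then show "((\<lambda>s. x s i) has_real_derivative F (x t) i) (at t within {0..<T})" if "i \<in> I" for i
        using sol t(1) that F' unfolding solves_on_def by metis
    qed (use t e in auto)
    have quad': "a * (state_dist I y z)\<^sup>2 \<le> V y \<and> V y \<le> b * (state_dist I y z)\<^sup>2"
      if "state_dist I y z < e" for y
      using quad[of y] that e by simp
    note confinement = lyapunov_confinement[of a b c I z e V T x t, OF \<open>a > 0\<close> \<open>a \<le> b\<close>]
    show ?thesis
    proof
      show "state_dist I (x t) z < e"
        by (rule confinement(1))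
           (fact less_imp_le[OF \<open>c > 0\<close>] quad' solves_on_continuous[OF sol] decay' start[OF x0] e(1) t)+
      show "a * (state_dist I (x t) z)\<^sup>2 \<le> b * (state_dist I (x 0) z)\<^sup>2 * exp (- c * t)"
        by (rule confinement(2))
           (fact less_imp_le[OF \<open>c > 0\<close>] quad' solves_on_continuous[OF sol] decay' start[OF x0] e(1) t)+
    qed
  qed
  have "lyapunov_stable I F z"
    unfolding lyapunov_stable_def
  proof (intro allI impI)
    fix e :: real assume "e > 0"
    define e' where "e' = min e r"
    have e': "0 < e'" "e' \<le> r" "e' \<le> e" using \<open>e > 0\<close> \<open>r > 0\<close> by (auto simp: e'_def)
    have "(\<exists>x. solves_on I F x {0..} \<and> (\<forall>i\<in>I. x 0 i = y i)) \<and>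
          (\<forall>x T. T > 0 \<longrightarrow> solves_on I F x {0..<T} \<longrightarrow> (\<forall>i\<in>I. x 0 i = y i) \<longrightarrow>
             (\<forall>t\<in>{0..<T}. state_dist I (x t) z < e))"
      if y: "state_dist I y z < q * e'" for y
    proof (intro conjI allI impI ballI)
      have "\<exists>x F'. solves_on I F' x {0..} \<and> (\<forall>i\<in>I. x 0 i = y i) \<and>
              (\<forall>x. \<forall>i\<in>I. (\<forall>j\<in>I. \<bar>x j - z j\<bar> \<le> r) \<longrightarrow> F' x i = F x i)"
        by (rule global_solution_of_clamped_field[OF fin \<open>L \<ge> 0\<close> less_imp_le[OF \<open>r > 0\<close>]]) (fact lip)
      then obtain x F' where x: "solves_on I F' x {0..}" "\<forall>i\<in>I. x 0 i = y i"
        and F': "\<And>x i. i \<in> I \<Longrightarrow> (\<forall>j\<in>I. \<bar>x j - z j\<bar> \<le> r) \<Longrightarrow> F' x i = F x i"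
        by blast
      have near: "\<bar>x t i - z i\<bar> \<le> r" if "t \<in> {0..}" "i \<in> I" for t i
      proof -
        have "solves_on I F' x {0..<t + 1}"
          using x(1) by (rule solves_on_subset) auto
        moreover have "state_dist I (x 0) z < q * e'"
          using y state_dist_cong[of I "x 0" y z] x(2) by simp
        ultimately have "state_dist I (x t) z < e'"
          using confine[of F' x "t + 1" t e'] F' e' that by auto
        then show ?thesis
          using abs_coord_le_state_dist[OF fin that(2), of "x t" z] e' by simp
      qed
      have "solves_on I F x {0..}"
        using x(1) near F' unfolding solves_on_def by metis
      then show "\<exists>x. solves_on I F x {0..} \<and> (\<forall>i\<in>I. x 0 i = y i)"
        using x(2) by blast
    next
      fix x T t
      assume "solves_on I F x {0..<T}" "\<forall>i\<in>I. x 0 i = y i" "t \<in> {0..<T}"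
      then show "state_dist I (x t) z < e"
        using confine[of F x T t e'] e' y state_dist_cong[of I "x 0" y z] by auto
    qed
    then show "\<exists>d>0. \<forall>y. state_dist I y z < d \<longrightarrow>
          (\<exists>x. solves_on I F x {0..} \<and> (\<forall>i\<in>I. x 0 i = y i)) \<and>
          (\<forall>x T. T > 0 \<longrightarrow> solves_on I F x {0..<T} \<longrightarrow> (\<forall>i\<in>I. x 0 i = y i) \<longrightarrow>
             (\<forall>t\<in>{0..<T}. state_dist I (x t) z < e))"
      using q e' by (intro exI[of _ "q * e'"]) auto
  qed
  moreover have "((\<lambda>t. state_dist I (x t) z) \<longlongrightarrow> 0) at_top"
    if sol: "solves_on I F x {0..}" and x0: "state_dist I (x 0) z < q * r" for x
  proof -
    define C where "C = b * (state_dist I (x 0) z)\<^sup>2 / a"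
    have bound: "(state_dist I (x t) z)\<^sup>2 \<le> C * exp (- c * t)" if "t \<ge> 0" for t
    proof -
      have "solves_on I F x {0..<t + 1}"
        using sol by (rule solves_on_subset) auto
      then show ?thesis
        using confine[of F x "t + 1" t r] that x0 \<open>r > 0\<close> \<open>a > 0\<close> by (auto simp: C_def field_simps)
    qed
    have "((\<lambda>t. C * exp (- c * t)) \<longlongrightarrow> C * 0) at_top"
      using \<open>c > 0\<close> by real_asymp
    then have lim: "((\<lambda>t. C * exp (- c * t)) \<longlongrightarrow> 0) at_top" by simp
    have "((\<lambda>t. (state_dist I (x t) z)\<^sup>2) \<longlongrightarrow> 0) at_top"
    proof (rule Lim_null_comparison[OF eventually_at_top_linorderI[of 0] lim])
      show "norm ((state_dist I (x t) z)\<^sup>2) \<le> C * exp (- c * t)" if "0 \<le> t" for t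
        using bound[OF that] by simp
    qed
    then have "((\<lambda>t. sqrt ((state_dist I (x t) z)\<^sup>2)) \<longlongrightarrow> sqrt 0) at_top"
      by (rule tendsto_real_sqrt)
    then show ?thesis by (simp add: state_dist_nonneg)
  qed
  ultimately show ?thesis
    unfolding asymptotically_stable_def using q \<open>r > 0\<close>
    by (intro conjI exI[of _ "q * r"]) auto
qed

text \<open>
  If \<open>z\<close> were stable, some solution starting at a point near \<open>z\<close> other than \<open>z\<close> would exist for all
  times and remain in the ball of radius \<open>r\<close>, where \<open>V\<close> is bounded; but \<open>V\<close> is positive initially and
  grows at least like \<open>exp (c * t)\<close>. Existence of the solution comes from the
  assumed stability.
\<close>

theorem unstable_of_quadratic_growth:
  assumes fin: "finite I" and "I \<noteq> {}" and "r > 0" and "a > 0" and "c > 0"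
    and quad: "\<And>y. state_dist I y z < r \<Longrightarrow>
                 a * (state_dist I y z)\<^sup>2 \<le> V y \<and> V y \<le> b * (state_dist I y z)\<^sup>2"
    and growth: "\<And>x J t. state_dist I (x t) z < r \<Longrightarrow>
                 (\<And>i. i \<in> I \<Longrightarrow> ((\<lambda>s. x s i) has_real_derivative F (x t) i) (at t within J)) \<Longrightarrow>
                 \<exists>D. ((\<lambda>s. V (x s)) has_real_derivative D) (at t within J) \<and> D \<ge> c * V (x t)"
  shows "unstable I F z"
  unfolding unstable_def
proof
  assume stable: "lyapunov_stable I F z"
  obtain d where "d > 0" and d:
    "\<And>y. state_dist I y z < d \<Longrightarrow> \<exists>x. solves_on I F x {0..} \<and> (\<forall>i\<in>I. x 0 i = y i)"
    "\<And>y x T t. state_dist I y z < d \<Longrightarrow> T > 0 \<Longrightarrow> solves_on I F x {0..<T} \<Longrightarrow>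
       \<forall>i\<in>I. x 0 i = y i \<Longrightarrow> t \<in> {0..<T} \<Longrightarrow> state_dist I (x t) z < r"
  proof -
    from stable \<open>r > 0\<close> obtain d where "d > 0"
      and d: "\<forall>y. state_dist I y z < d \<longrightarrow>
        (\<exists>x. solves_on I F x {0..} \<and> (\<forall>i\<in>I. x 0 i = y i)) \<and>
        (\<forall>x T. T > 0 \<longrightarrow> solves_on I F x {0..<T} \<longrightarrow> (\<forall>i\<in>I. x 0 i = y i) \<longrightarrow>
           (\<forall>t\<in>{0..<T}. state_dist I (x t) z < r))"
      unfolding lyapunov_stable_def by (elim allE[of _ r] impE exE conjE)
    show thesis
    proof (rule that[OF \<open>d > 0\<close>])
      show "\<exists>x. solves_on I F x {0..} \<and> (\<forall>i\<in>I. x 0 i = y i)" if "state_dist I y z < d" for y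
        using d[rule_format, OF that] by (rule conjunct1)
      show "state_dist I (x t) z < r"
        if "state_dist I y z < d" "T > 0" "solves_on I F x {0..<T}" "\<forall>i\<in>I. x 0 i = y i" "t \<in> {0..<T}"
        for y x T t
        using conjunct2[OF d[THEN spec, THEN mp, OF that(1)], THEN spec, THEN spec, THEN mp, THEN mp, THEN mp, THEN bspec, OF that(2-5)] .
    qed
  qed
  obtain i where i: "i \<in> I" using \<open>I \<noteq> {}\<close> by blast
  define y where "y = z(i := z i + d / 2)"
  have "state_dist I y z \<le> (\<Sum>j\<in>I. \<bar>y j - z j\<bar>)" by (rule state_dist_le_sum)
  also have "\<dots> = (\<Sum>j\<in>I. if j = i then d / 2 else 0)"
    using \<open>d > 0\<close> by (intro sum.cong) (auto simp: y_def)
  also have "\<dots> < d" using fin i \<open>d > 0\<close> by simp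
  finally have y: "state_dist I y z < d" .
  then obtain x where x: "solves_on I F x {0..}" "\<forall>i\<in>I. x 0 i = y i"
    using d(1) by blast
  have sub: "solves_on I F x {0..<T}" for T
    using x(1) by (rule solves_on_subset) auto
  have near: "state_dist I (x t) z < r" if "t \<ge> 0" for t
    by (rule d(2)[OF y _ sub[of "t + 1"] x(2)]) (use that in auto)
  have grow: "V (x 0) * exp (c * t) \<le> V (x t)" if "t \<ge> 0" for t
  proof -
    have "- V (x t) \<le> - V (x 0) * exp (- (- c) * t)"
    proof (rule exponential_decay_of_derivative_bound[OF that, where v = "\<lambda>t. - V (x t)"])
      fix s assume s: "s \<in> {0..t}"
      have "((\<lambda>s. x s i) has_real_derivative F (x s) i) (at s within {0..t})" if "i \<in> I" for i
        using solves_on_subset[OF x(1), of "{0..t}"] s that unfolding solves_on_def by auto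
      with growth[of x s "{0..t}"] near[of s] s obtain D
        where "((\<lambda>s. V (x s)) has_real_derivative D) (at s within {0..t})" "D \<ge> c * V (x s)"
        by auto
      then show "\<exists>D. ((\<lambda>t. - V (x t)) has_real_derivative D) (at s within {0..t}) \<and> D \<le> - (- c) * - V (x s)"
        by (intro exI[of _ "- D"]) (auto intro: derivative_intros)
    qed
    then show ?thesis by simp
  qed
  have "state_dist I (x 0) z \<ge> \<bar>x 0 i - z i\<bar>"
    using fin i by (rule abs_coord_le_state_dist)
  then have "state_dist I (x 0) z > 0"
    using x(2) i \<open>d > 0\<close> by (auto simp: y_def)
  then have "a * (state_dist I (x 0) z)\<^sup>2 > 0" using \<open>a > 0\<close> by simp
  with quad[OF near[of 0]] have V0: "V (x 0) > 0" by simp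
  define M where "M = \<bar>b\<bar> * r\<^sup>2"
  have bounded: "V (x t) \<le> M" if "t \<ge> 0" for t
  proof -
    have "V (x t) \<le> \<bar>b\<bar> * (state_dist I (x t) z)\<^sup>2"
      using quad[OF near[OF that]] by (smt (verit) mult_right_mono zero_le_power2)
    also have "\<dots> \<le> M"
      unfolding M_def using near[OF that] state_dist_nonneg
      by (intro mult_left_mono power_mono) (auto intro: less_imp_le)
    finally show ?thesis .
  qed
  \<comment> \<open>At this time \<open>V (x 0) * (1 + c * t)\<close>, a lower bound for \<open>V (x t)\<close>, equals \<open>V (x 0) + M\<close>.\<close>
  define t where "t = M / (c * V (x 0))"
  have "M \<ge> 0" by (simp add: M_def)
  then have "t \<ge> 0" using V0 \<open>c > 0\<close> by (simp add: t_def)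
  have "M < V (x 0) * (1 + c * t)"
    using V0 \<open>c > 0\<close> by (simp add: t_def field_simps)
  also have "\<dots> \<le> V (x 0) * exp (c * t)"
    using V0 by (intro mult_left_mono) auto
  also have "\<dots> \<le> M" using grow[OF \<open>t \<ge> 0\<close>] bounded[OF \<open>t \<ge> 0\<close>] by simp
  finally show False by simp
qed

section \<open>The stored energy of a strain on an increasing branch\<close>

lemma mult_nonneg_of_nonneg_derivative:
  fixes g g' :: "real \<Rightarrow> real"
  assumes "g 0 = 0" and s: "\<bar>s\<bar> \<le> \<rho>"
    and g: "\<And>u. \<bar>u\<bar> \<le> \<rho> \<Longrightarrow> (g has_real_derivative g' u) (at u)"
    and nonneg: "\<And>u. \<bar>u\<bar> \<le> \<rho> \<Longrightarrow> g' u \<ge> 0"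
  shows "s * g s \<ge> 0"
proof (cases "s \<ge> 0")
  case True
  have "g 0 \<le> g s"
  proof (rule DERIV_nonneg_imp_nondecreasing[OF True])
    fix u assume "0 \<le> u" "u \<le> s"
    then have "\<bar>u\<bar> \<le> \<rho>" using s by auto
    then show "\<exists>y. (g has_real_derivative y) (at u) \<and> 0 \<le> y" using g nonneg by blast
  qed
  then show ?thesis using True \<open>g 0 = 0\<close> by simp
next
  case False
  then have "s \<le> 0" by simp
  have "g s \<le> g 0"
  proof (rule DERIV_nonneg_imp_nondecreasing[OF \<open>s \<le> 0\<close>])
    fix u assume "s \<le> u" "u \<le> 0"
    then have "\<bar>u\<bar> \<le> \<rho>" using s by auto
    then show "\<exists>y. (g has_real_derivative y) (at u) \<and> 0 \<le> y" using g nonneg by blast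
  qed
  then show ?thesis using \<open>s \<le> 0\<close> \<open>g 0 = 0\<close> by (simp add: mult_nonpos_nonpos)
qed

lemma nonneg_of_sign_derivative:
  fixes f g :: "real \<Rightarrow> real"
  assumes "f 0 = 0" and s: "\<bar>s\<bar> \<le> \<rho>"
    and f: "\<And>u. \<bar>u\<bar> \<le> \<rho> \<Longrightarrow> (f has_real_derivative g u) (at u)"
    and sign: "\<And>u. \<bar>u\<bar> \<le> \<rho> \<Longrightarrow> u * g u \<ge> 0"
  shows "f s \<ge> 0"
proof -
  have cont: "continuous_on {u. \<bar>u\<bar> \<le> \<rho>} f"
    by (rule DERIV_continuous_on, rule has_field_derivative_at_within, rule f) simp
  show ?thesis
  proof (cases "s \<ge> 0")
    case True
    have "f 0 \<le> f s"
    proof (rule DERIV_nonneg_imp_increasing_open[OF True])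
      fix u assume "0 < u" "u < s"
      then have u: "\<bar>u\<bar> \<le> \<rho>" using s by auto
      have "g u \<ge> 0" using sign[OF u] \<open>0 < u\<close> by (simp add: zero_le_mult_iff)
      then show "\<exists>y. (f has_real_derivative y) (at u) \<and> 0 \<le> y" using f[OF u] by blast
    qed (rule continuous_on_subset[OF cont], use s in auto)
    then show ?thesis using \<open>f 0 = 0\<close> by simp
  next
    case False
    then have "s \<le> 0" by simp
    have "f s \<ge> f 0"
    proof (rule DERIV_nonpos_imp_decreasing_open[OF \<open>s \<le> 0\<close>])
      fix u assume "s < u" "u < 0"
      then have u: "\<bar>u\<bar> \<le> \<rho>" using s by auto
      have "g u \<le> 0" using sign[OF u] \<open>u < 0\<close> by (simp add: zero_le_mult_iff)
      then show "\<exists>y. (f has_real_derivative y) (at u) \<and> y \<le> 0" using f[OF u] by blast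
    qed (rule continuous_on_subset[OF cont], use s False in auto)
    then show ?thesis using \<open>f 0 = 0\<close> by simp
  qed
qed

text \<open>
  By continuity \<open>\<sigma>'\<close> lies between \<open>m = \<sigma>' P / 2\<close> and \<open>M = 3 * \<sigma>' P / 2\<close> near \<open>P\<close>, and integrating once
  and twice turns this into bounds for the excess stress and for its primitive \<open>W\<close>, the elastic energy
  stored in a strain \<open>P + s\<close> relative to the tangent at \<open>P\<close>.
\<close>

lemma stored_energy_near_increasing_point:
  fixes \<sigma> \<sigma>' :: "real \<Rightarrow> real"
  assumes deriv: "\<And>\<xi>. (\<sigma> has_real_derivative \<sigma>' \<xi>) (at \<xi>)"
    and "continuous_on UNIV \<sigma>'" and "\<sigma>' P > 0"
  obtains \<rho> m M W where "\<rho> > 0" "m > 0" "m \<le> M"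
    and "\<And>\<xi> \<eta>. \<bar>\<xi> - P\<bar> \<le> \<rho> \<Longrightarrow> \<bar>\<eta> - P\<bar> \<le> \<rho> \<Longrightarrow> \<bar>\<sigma> \<xi> - \<sigma> \<eta>\<bar> \<le> M * \<bar>\<xi> - \<eta>\<bar>"
    and "\<And>s. \<bar>s\<bar> \<le> \<rho> \<Longrightarrow> m * s\<^sup>2 \<le> s * (\<sigma> (P + s) - \<sigma> P)"
    and "\<And>s. \<bar>s\<bar> \<le> \<rho> \<Longrightarrow> (W has_real_derivative \<sigma> (P + s) - \<sigma> P) (at s)"
    and "\<And>s. \<bar>s\<bar> \<le> \<rho> \<Longrightarrow> m / 2 * s\<^sup>2 \<le> W s"
    and "\<And>s. \<bar>s\<bar> \<le> \<rho> \<Longrightarrow> W s \<le> M / 2 * s\<^sup>2"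
proof -
  define m where "m = \<sigma>' P / 2"
  define M where "M = 3 * \<sigma>' P / 2"
  have "isCont \<sigma>' P"
    using assms(2) by (simp add: continuous_on_eq_continuous_at)
  then obtain d where "d > 0" and d: "\<And>\<xi>. \<bar>\<xi> - P\<bar> < d \<Longrightarrow> \<bar>\<sigma>' \<xi> - \<sigma>' P\<bar> < \<sigma>' P / 2"
    using \<open>\<sigma>' P > 0\<close> unfolding continuous_at_eps_delta dist_real_def by (metis half_gt_zero)
  define \<rho> where "\<rho> = d / 2"
  have \<sigma>': "m \<le> \<sigma>' \<xi>" "\<sigma>' \<xi> \<le> M" if "\<bar>\<xi> - P\<bar> \<le> \<rho>" for \<xi>
  proof -
    have "\<bar>\<xi> - P\<bar> < d" using that \<open>d > 0\<close> by (simp add: \<rho>_def)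
    then have "\<bar>\<sigma>' \<xi> - \<sigma>' P\<bar> < \<sigma>' P / 2" by (rule d)
    then show "m \<le> \<sigma>' \<xi>" "\<sigma>' \<xi> \<le> M"
      unfolding m_def M_def abs_less_iff by linarith+
  qed
  have "continuous_on {P - d..P + d} \<sigma>"
    using deriv by (meson DERIV_continuous_on has_field_derivative_at_within)
  then obtain \<Phi> where \<Phi>:
      "\<And>\<xi>. \<xi> \<in> {P - d..P + d} \<Longrightarrow> (\<Phi> has_vector_derivative \<sigma> \<xi>) (at \<xi> within {P - d..P + d})"
    using antiderivative_continuous by blast
  define W where "W s = \<Phi> (P + s) - \<Phi> P - \<sigma> P * s" for s
  have W: "(W has_real_derivative \<sigma> (P + s) - \<sigma> P) (at s)" if "\<bar>s\<bar> \<le> \<rho>" for s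
  proof -
    have s: "P - d < P + s" "P + s < P + d" using that \<open>d > 0\<close> by (auto simp: \<rho>_def)
    then have "at (P + s) within {P - d..P + d} = at (P + s)"
      by (intro at_within_interior) simp
    with \<Phi>[of "P + s"] s have "(\<Phi> has_real_derivative \<sigma> (P + s)) (at (P + s))"
      by (simp add: has_real_derivative_iff_has_vector_derivative)
    then have "((\<lambda>s. \<Phi> (P + s)) has_real_derivative \<sigma> (P + s)) (at s)"
      using DERIV_shift[of \<Phi> "\<sigma> (P + s)" s P] by (simp add: add.commute)
    then show ?thesis
      unfolding W_def by (auto intro!: derivative_eq_intros)
  qed
  have "W 0 = 0" by (simp add: W_def)
  have shift: "((\<lambda>s. \<sigma> (P + s)) has_real_derivative \<sigma>' (P + s)) (at s)" for s
    using deriv[of "P + s"] DERIV_shift[of \<sigma> "\<sigma>' (P + s)" s P] by (simp add: add.commute)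
  have low: "s * ((\<sigma> (P + s) - \<sigma> P) - m * s) \<ge> 0" if "\<bar>s\<bar> \<le> \<rho>" for s
    by (rule mult_nonneg_of_nonneg_derivative[where \<rho> = \<rho> and g' = "\<lambda>u. \<sigma>' (P + u) - m"])
       (use that \<sigma>'[of "P + _"] in \<open>auto intro!: derivative_eq_intros shift\<close>)
  have up: "s * (M * s - (\<sigma> (P + s) - \<sigma> P)) \<ge> 0" if "\<bar>s\<bar> \<le> \<rho>" for s
    by (rule mult_nonneg_of_nonneg_derivative[where \<rho> = \<rho> and g' = "\<lambda>u. M - \<sigma>' (P + u)"])
       (use that \<sigma>'[of "P + _"] in \<open>auto intro!: derivative_eq_intros shift\<close>)
  show thesis
  proof
    show "\<rho> > 0" "m > 0" "m \<le> M" using \<open>d > 0\<close> \<open>\<sigma>' P > 0\<close> by (auto simp: \<rho>_def m_def M_def)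
    show "\<bar>\<sigma> \<xi> - \<sigma> \<eta>\<bar> \<le> M * \<bar>\<xi> - \<eta>\<bar>" if "\<bar>\<xi> - P\<bar> \<le> \<rho>" "\<bar>\<eta> - P\<bar> \<le> \<rho>" for \<xi> \<eta>
    proof -
      have "norm (\<sigma> \<xi> - \<sigma> \<eta>) \<le> M * norm (\<xi> - \<eta>)"
      proof (rule field_differentiable_bound[of "{P - \<rho>..P + \<rho>}" \<sigma> \<sigma>'])
        show "norm (\<sigma>' z) \<le> M" if "z \<in> {P - \<rho>..P + \<rho>}" for z
          using \<sigma>'[of z] that \<open>m > 0\<close> by (auto simp: abs_le_iff)
      qed (use that deriv in \<open>auto intro: has_field_derivative_at_within simp: abs_le_iff\<close>)
      then show ?thesis by simp
    qed
    show "m * s\<^sup>2 \<le> s * (\<sigma> (P + s) - \<sigma> P)" if "\<bar>s\<bar> \<le> \<rho>" for s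
      using low[OF that] by (simp add: algebra_simps power2_eq_square)
    show "(W has_real_derivative \<sigma> (P + s) - \<sigma> P) (at s)" if "\<bar>s\<bar> \<le> \<rho>" for s
      using W[OF that] .
    show "m / 2 * s\<^sup>2 \<le> W s" if "\<bar>s\<bar> \<le> \<rho>" for s
    proof -
      have "0 \<le> W s - m / 2 * s\<^sup>2"
      proof (rule nonneg_of_sign_derivative[OF _ that])
        show "((\<lambda>s. W s - m / 2 * s\<^sup>2) has_real_derivative (\<sigma> (P + u) - \<sigma> P) - m * u) (at u)"
          if "\<bar>u\<bar> \<le> \<rho>" for u
          using W[OF that] by (auto intro!: derivative_eq_intros)
      qed (use low \<open>W 0 = 0\<close> in auto)
      then show ?thesis by simp
    qed
    show "W s \<le> M / 2 * s\<^sup>2" if "\<bar>s\<bar> \<le> \<rho>" for s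
    proof -
      have "0 \<le> M / 2 * s\<^sup>2 - W s"
      proof (rule nonneg_of_sign_derivative[OF _ that])
        show "((\<lambda>s. M / 2 * s\<^sup>2 - W s) has_real_derivative M * u - (\<sigma> (P + u) - \<sigma> P)) (at u)"
          if "\<bar>u\<bar> \<le> \<rho>" for u
          using W[OF that] by (auto intro!: derivative_eq_intros)
      qed (use up \<open>W 0 = 0\<close> in auto)
      then show ?thesis by simp
    qed
  qed
qed

section \<open>Difference quotients on a uniform grid\<close>

definition slope :: "nat \<Rightarrow> (nat \<Rightarrow> real) \<Rightarrow> nat \<Rightarrow> real" where
  "slope n w k = real n * (w k - w (k - 1))"

lemma sum_slope_by_parts:
  assumes "n \<ge> 1" "a 0 = 0" "a n = 0"
  shows "(\<Sum>k=1..n-1. a k * (real n * (q (k + 1) - q k))) = - (\<Sum>k=1..n. q k * slope n a k)"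
proof -
  have "(\<Sum>k=1..m. a k * (real n * (q (k + 1) - q k))) + (\<Sum>k=1..Suc m. q k * slope n a k)
          = real n * (q (Suc m) * a (Suc m) - q 1 * a 0)" for m
    by (induction m) (auto simp: slope_def algebra_simps)
  from this[of "n - 1"] show ?thesis using assms by simp
qed

text \<open>
  Each value is a telescoping sum of at most \<open>n\<close> increments, so Cauchy-Schwarz bounds its square by \<open>n\<close>
  times the sum of the squared increments. Summing over the \<open>n\<close> points gives \<open>n\<^sup>2\<close>, which is
  exactly the factor contained in the squared slopes.
\<close>

lemma discrete_poincare:
  assumes "w 0 = 0"
  shows "(\<Sum>k=1..n. (w k)\<^sup>2) \<le> (\<Sum>k=1..n. (slope n w k)\<^sup>2)"
proof -
  define d where "d k = w k - w (k - 1)" for k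
  have "(w k)\<^sup>2 \<le> real n * (\<Sum>j=1..n. (d j)\<^sup>2)" if "k \<in> {1..n}" for k
  proof -
    have "w k = (\<Sum>j=1..k. d j)"
      using assms by (induction k) (auto simp: d_def)
    then have "(w k)\<^sup>2 \<le> (\<Sum>j=1..k. (d j)\<^sup>2) * card {1..k}"
      using sum_squared_le_sum_of_squares[of d "{1..k}"] by simp
    also have "\<dots> \<le> (\<Sum>j=1..n. (d j)\<^sup>2) * n"
      using that by (intro mult_mono sum_mono2 sum_nonneg) auto
    finally show ?thesis by (simp add: mult.commute)
  qed
  then have "(\<Sum>k=1..n. (w k)\<^sup>2) \<le> (\<Sum>k=1..n. real n * (\<Sum>j=1..n. (d j)\<^sup>2))"
    by (rule sum_mono)
  also have "\<dots> = (\<Sum>k=1..n. (slope n w k)\<^sup>2)"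
    by (simp add: slope_def d_def power_mult_distrib sum_distrib_left power2_eq_square mult_ac)
  finally show ?thesis .
qed

text \<open>
  The converse of the Poincare inequality, available because the grid is finite. It lets the
  energy be bounded above by the distance of states, which sees displacements rather than strains.
\<close>

lemma slope_sum_squares_le:
  assumes "w 0 = 0"
  shows "(\<Sum>k=1..n. (slope n w k)\<^sup>2) \<le> 4 * (real n)\<^sup>2 * (\<Sum>k=1..n. (w k)\<^sup>2)"
proof -
  have shift: "(\<Sum>k=1..n. (w (k - 1))\<^sup>2) \<le> (\<Sum>k=1..n. (w k)\<^sup>2)"
  proof -
    have "(\<Sum>k=1..m. (w (k - 1))\<^sup>2) + (w m)\<^sup>2 = (\<Sum>k=1..m. (w k)\<^sup>2)" for m
      using assms by (induction m) auto
    from this[of n] show ?thesis by (smt (verit) zero_le_power2)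
  qed
  have "(slope n w k)\<^sup>2 \<le> (real n)\<^sup>2 * (2 * (w k)\<^sup>2 + 2 * (w (k - 1))\<^sup>2)" for k
  proof -
    have "(w k - w (k - 1))\<^sup>2 \<le> 2 * (w k)\<^sup>2 + 2 * (w (k - 1))\<^sup>2"
      using zero_le_power2[of "w k + w (k - 1)"] by (simp add: power2_eq_square algebra_simps)
    then show ?thesis
      unfolding slope_def power_mult_distrib by (intro mult_left_mono) auto
  qed
  then have "(\<Sum>k=1..n. (slope n w k)\<^sup>2)
      \<le> (\<Sum>k=1..n. (real n)\<^sup>2 * (2 * (w k)\<^sup>2 + 2 * (w (k - 1))\<^sup>2))"
    by (rule sum_mono)
  also have "\<dots> = (real n)\<^sup>2 * (2 * (\<Sum>k=1..n. (w k)\<^sup>2) + 2 * (\<Sum>k=1..n. (w (k - 1))\<^sup>2))"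
    by (simp add: sum_distrib_left sum.distrib distrib_left)
  also have "\<dots> \<le> (real n)\<^sup>2 * (4 * (\<Sum>k=1..n. (w k)\<^sup>2))"
    using shift by (intro mult_left_mono) auto
  finally show ?thesis by (simp add: mult_ac)
qed

section \<open>The chain in displacement and velocity coordinates\<close>

text \<open>
  Displacement and velocity include the two fixed end points, where both vanish; this is what
  makes summation by parts and the Poincare inequality applicable to them.
\<close>

definition displacement :: "nat \<Rightarrow> real \<Rightarrow> (nat + nat \<Rightarrow> real) \<Rightarrow> nat \<Rightarrow> real" where
  "displacement n P x k = with_ends n P (\<lambda>k. x (Inl k)) k - real k * mesh n * P"

definition velocity :: "nat \<Rightarrow> (nat + nat \<Rightarrow> real) \<Rightarrow> nat \<Rightarrow> real" where
  "velocity n x k = with_ends n 0 (\<lambda>k. x (Inr k)) k"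

text \<open>
  The elastic and viscous force transmitted by the \<open>k\<close>-th spring, with its equilibrium value \<open>\<sigma> P\<close>
  subtracted. The acceleration of a mass is the difference quotient of this force.
\<close>

definition excess_stress ::
  "(real \<Rightarrow> real) \<Rightarrow> real \<Rightarrow> nat \<Rightarrow> real \<Rightarrow> (nat \<Rightarrow> real) \<Rightarrow> (nat \<Rightarrow> real) \<Rightarrow> nat \<Rightarrow> real" where
  "excess_stress \<sigma> \<epsilon> n P w v k = \<sigma> (P + slope n w k) - \<sigma> P + \<epsilon> * slope n v k"

lemma displacement_ends:
  assumes "n \<ge> 1"
  shows "displacement n P x 0 = 0" "displacement n P x n = 0"
  using assms by (auto simp: displacement_def with_ends_def mesh_def)

lemma velocity_ends: "velocity n x 0 = 0" "velocity n x n = 0"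
  by (auto simp: velocity_def with_ends_def)

lemma chain_field_Inl:
  "chain_field \<sigma> \<epsilon> n P x (Inl k) = velocity n x k"
  by (simp add: chain_field_def velocity_def Let_def)

lemma chain_field_Inr:
  assumes "k \<in> {1..n - 1}"
  shows "chain_field \<sigma> \<epsilon> n P x (Inr k) = real n *
    (excess_stress \<sigma> \<epsilon> n P (displacement n P x) (velocity n x) (k + 1) -
     excess_stress \<sigma> \<epsilon> n P (displacement n P x) (velocity n x) k)"
proof -
  have "n > 0" using assms by auto
  have strain: "strain n (with_ends n P (\<lambda>k. x (Inl k))) j = P + slope n (displacement n P x) j"
    if "j \<ge> 1" for j
    using that \<open>n > 0\<close> by (simp add: strain_def slope_def displacement_def mesh_def of_nat_diff field_simps)
  have vel: "with_ends n 0 (\<lambda>k. x (Inr k)) = velocity n x"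
    by (simp add: velocity_def fun_eq_iff)
  have viscous: "\<epsilon> / (mesh n)\<^sup>2 * (v (k + 1) - 2 * v k + v (k - 1))
      = real n * (\<epsilon> * slope n v (k + 1) - \<epsilon> * slope n v k)" for v
    by (simp add: slope_def mesh_def power2_eq_square algebra_simps)
  have k: "k \<ge> 1" "k + 1 \<ge> 1" using assms by auto
  show ?thesis
    unfolding chain_field_def Let_def sum.case vel strain[OF k(1)] strain[OF k(2)] viscous excess_stress_def
    by (simp add: mesh_def right_diff_distrib distrib_left)
qed

lemma displacement_diff:
  "displacement n P x k - displacement n P y k =
     (if k = 0 \<or> k = n then 0 else x (Inl k) - y (Inl k))"
  by (simp add: displacement_def with_ends_def)

lemma velocity_diff:
  "velocity n x k - velocity n y k = (if k = 0 \<or> k = n then 0 else x (Inr k) - y (Inr k))"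
  by (simp add: velocity_def with_ends_def)

lemma displacement_uniphase: "n \<ge> 1 \<Longrightarrow> displacement n P (uniphase n P) k = 0"
  by (auto simp: displacement_def with_ends_def uniphase_def mesh_def)

lemma finite_chain_index: "finite (chain_index n)"
  by (simp add: chain_index_def)

lemma abs_displacement_diff_le:
  assumes "k \<le> n" and "\<forall>i\<in>chain_index n. \<bar>x i - y i\<bar> \<le> d" and "d \<ge> 0"
  shows "\<bar>displacement n P x k - displacement n P y k\<bar> \<le> d"
  using assms by (auto simp: displacement_diff chain_index_def)

lemma abs_velocity_diff_le:
  assumes "k \<le> n" and "\<forall>i\<in>chain_index n. \<bar>x i - y i\<bar> \<le> d" and "d \<ge> 0"
  shows "\<bar>velocity n x k - velocity n y k\<bar> \<le> d"
  using assms by (auto simp: velocity_diff chain_index_def)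

lemma abs_slope_diff_le:
  assumes "k \<le> n" and "\<And>j. j \<le> n \<Longrightarrow> \<bar>w j - w' j\<bar> \<le> d"
  shows "\<bar>slope n w k - slope n w' k\<bar> \<le> 2 * real n * d"
proof -
  have "slope n w k - slope n w' k = real n * ((w k - w' k) - (w (k - 1) - w' (k - 1)))"
    by (simp add: slope_def algebra_simps)
  then have "\<bar>slope n w k - slope n w' k\<bar> = real n * \<bar>(w k - w' k) - (w (k - 1) - w' (k - 1))\<bar>"
    by (simp add: abs_mult)
  also have "\<bar>(w k - w' k) - (w (k - 1) - w' (k - 1))\<bar> \<le> 2 * d"
  proof -
    have "\<bar>w k - w' k\<bar> \<le> d" "\<bar>w (k - 1) - w' (k - 1)\<bar> \<le> d"
      using assms by auto
    then show ?thesis by linarith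
  qed
  finally show ?thesis by (simp add: mult_left_mono)
qed

lemma state_dist_uniphase_sq:
  assumes "n \<ge> 1"
  shows "(state_dist (chain_index n) x (uniphase n P))\<^sup>2 =
    (\<Sum>k=1..n. (displacement n P x k)\<^sup>2) + (\<Sum>k=1..n. (velocity n x k)\<^sup>2)"
proof -
  have split: "(\<Sum>k=1..n. f k) = (\<Sum>k=1..n-1. f k)" if "f n = 0" for f :: "nat \<Rightarrow> real"
    using assms that by (cases n) auto
  have "(\<Sum>k=1..n. (displacement n P x k)\<^sup>2) = (\<Sum>k=1..n-1. (x (Inl k) - uniphase n P (Inl k))\<^sup>2)"
    using displacement_ends(2)[OF assms]
    by (subst split) (auto simp: displacement_def with_ends_def uniphase_def intro!: sum.cong)
  moreover have "(\<Sum>k=1..n. (velocity n x k)\<^sup>2) = (\<Sum>k=1..n-1. (x (Inr k) - uniphase n P (Inr k))\<^sup>2)"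
    using velocity_ends(2)
    by (subst split) (auto simp: velocity_def with_ends_def uniphase_def intro!: sum.cong)
  ultimately show ?thesis
    by (simp add: state_dist_sq chain_index_def sum.Plus)
qed

lemma slope_displacement_le:
  assumes "n \<ge> 1" "k \<le> n" "\<forall>i\<in>chain_index n. \<bar>x i - uniphase n P i\<bar> \<le> \<rho> / (2 * real n)" "\<rho> \<ge> 0"
  shows "\<bar>slope n (displacement n P x) k\<bar> \<le> \<rho>"
proof -
  have "\<bar>slope n (displacement n P x) k - slope n (displacement n P (uniphase n P)) k\<bar>
      \<le> 2 * real n * (\<rho> / (2 * real n))"
    using assms by (intro abs_slope_diff_le abs_displacement_diff_le) auto
  moreover have "slope n (displacement n P (uniphase n P)) k = 0"
    using assms(1) by (simp add: slope_def displacement_uniphase)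
  ultimately show ?thesis using assms(1) by simp
qed

text \<open>
  The radius \<open>\<rho> / (2 * real n)\<close> is chosen so that all strains of a state in the box are within \<open>\<rho>\<close> of \<open>P\<close>,
  where \<open>\<sigma>\<close> has Lipschitz constant \<open>M\<close>. Each slope costs a factor \<open>2 * real n\<close>, and so does the difference
  of the two neighbouring forces.
\<close>

lemma chain_field_lipschitz:
  assumes "n \<ge> 1" "\<rho> \<ge> 0" "M \<ge> 0"
    and lip: "\<And>\<xi> \<eta>. \<bar>\<xi> - P\<bar> \<le> \<rho> \<Longrightarrow> \<bar>\<eta> - P\<bar> \<le> \<rho> \<Longrightarrow> \<bar>\<sigma> \<xi> - \<sigma> \<eta>\<bar> \<le> M * \<bar>\<xi> - \<eta>\<bar>"
    and i: "i \<in> chain_index n"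
    and x: "\<forall>j\<in>chain_index n. \<bar>x j - uniphase n P j\<bar> \<le> \<rho> / (2 * real n)"
    and y: "\<forall>j\<in>chain_index n. \<bar>y j - uniphase n P j\<bar> \<le> \<rho> / (2 * real n)"
  shows "\<bar>chain_field \<sigma> \<epsilon> n P x i - chain_field \<sigma> \<epsilon> n P y i\<bar>
     \<le> (1 + 4 * (real n)\<^sup>2 * (M + \<bar>\<epsilon>\<bar>)) * state_dist (chain_index n) x y"
proof -
  define d where "d = state_dist (chain_index n) x y"
  have d: "d \<ge> 0" "\<forall>j\<in>chain_index n. \<bar>x j - y j\<bar> \<le> d"
    by (auto simp: d_def state_dist_nonneg intro: abs_coord_le_state_dist finite_chain_index)
  let ?q = "\<lambda>x. excess_stress \<sigma> \<epsilon> n P (displacement n P x) (velocity n x)"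
  have q: "\<bar>?q x k - ?q y k\<bar> \<le> (M + \<bar>\<epsilon>\<bar>) * (2 * real n * d)" if "k \<le> n" for k
  proof -
    let ?sx = "slope n (displacement n P x) k" and ?sy = "slope n (displacement n P y) k"
    let ?gx = "slope n (velocity n x) k" and ?gy = "slope n (velocity n y) k"
    have "\<bar>\<sigma> (P + ?sx) - \<sigma> (P + ?sy)\<bar> \<le> M * \<bar>(P + ?sx) - (P + ?sy)\<bar>"
      using slope_displacement_le[OF assms(1) that x assms(2)]
        slope_displacement_le[OF assms(1) that y assms(2)] by (intro lip) auto
    also have "\<dots> \<le> M * (2 * real n * d)"
      using abs_slope_diff_le[OF that, of "displacement n P x" "displacement n P y" d]
        abs_displacement_diff_le[OF _ d(2,1)] \<open>M \<ge> 0\<close> by (intro mult_left_mono) auto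
    finally have 1: "\<bar>\<sigma> (P + ?sx) - \<sigma> (P + ?sy)\<bar> \<le> M * (2 * real n * d)" .
    have "\<bar>\<epsilon> * ?gx - \<epsilon> * ?gy\<bar> = \<bar>\<epsilon>\<bar> * \<bar>?gx - ?gy\<bar>"
      by (simp add: abs_mult right_diff_distrib[symmetric])
    also have "\<dots> \<le> \<bar>\<epsilon>\<bar> * (2 * real n * d)"
      using abs_slope_diff_le[OF that, of "velocity n x" "velocity n y" d]
        abs_velocity_diff_le[OF _ d(2,1)] by (intro mult_left_mono) auto
    finally show ?thesis
      using 1 by (simp add: excess_stress_def distrib_right)
  qed
  have L: "0 \<le> 4 * (real n)\<^sup>2 * (M + \<bar>\<epsilon>\<bar>)" using \<open>M \<ge> 0\<close> by simp
  consider k where "i = Inl k" "k \<in> {1..n - 1}" | k where "i = Inr k" "k \<in> {1..n - 1}"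
    using i by (auto simp: chain_index_def)
  then show ?thesis
  proof cases
    case 1
    then have "k \<le> n" by auto
    with 1 have "\<bar>chain_field \<sigma> \<epsilon> n P x i - chain_field \<sigma> \<epsilon> n P y i\<bar> \<le> 1 * d"
      using abs_velocity_diff_le[OF _ d(2,1), of k] by (simp add: chain_field_Inl)
    also have "\<dots> \<le> (1 + 4 * (real n)\<^sup>2 * (M + \<bar>\<epsilon>\<bar>)) * d"
      using L d by (intro mult_right_mono) auto
    finally show ?thesis by (simp add: d_def)
  next
    case 2
    have "chain_field \<sigma> \<epsilon> n P x i - chain_field \<sigma> \<epsilon> n P y i
       = real n * ((?q x (k + 1) - ?q y (k + 1)) - (?q x k - ?q y k))"
      unfolding 2(1) chain_field_Inr[OF 2(2)] by (simp add: algebra_simps)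
    then have "\<bar>chain_field \<sigma> \<epsilon> n P x i - chain_field \<sigma> \<epsilon> n P y i\<bar>
       = real n * \<bar>(?q x (k + 1) - ?q y (k + 1)) - (?q x k - ?q y k)\<bar>"
      by (simp add: abs_mult)
    also have "\<dots> \<le> real n * (2 * ((M + \<bar>\<epsilon>\<bar>) * (2 * real n * d)))"
    proof (rule mult_left_mono)
      have "k \<le> n" "k + 1 \<le> n" using 2 by auto
      from q[OF this(1)] q[OF this(2)]
      show "\<bar>(?q x (k + 1) - ?q y (k + 1)) - (?q x k - ?q y k)\<bar> \<le> 2 * ((M + \<bar>\<epsilon>\<bar>) * (2 * real n * d))"
        by linarith
    qed simp
    also have "\<dots> = 4 * (real n)\<^sup>2 * (M + \<bar>\<epsilon>\<bar>) * d"
      by (simp add: power2_eq_square)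
    also have "\<dots> \<le> (1 + 4 * (real n)\<^sup>2 * (M + \<bar>\<epsilon>\<bar>)) * d"
      using d by (intro mult_right_mono) auto
    finally show ?thesis by (simp add: d_def)
  qed
qed

section \<open>The corrected energy\<close>

text \<open>
  All terms are summed up to \<open>n\<close>, since the chain has \<open>n\<close> springs; the terms with \<open>w n\<close> and \<open>v n\<close> vanish for the
  chain with fixed ends.
\<close>

definition chain_energy ::
  "(real \<Rightarrow> real) \<Rightarrow> real \<Rightarrow> real \<Rightarrow> nat \<Rightarrow> (nat \<Rightarrow> real) \<Rightarrow> (nat \<Rightarrow> real) \<Rightarrow> real" where
  "chain_energy W \<epsilon> \<delta> n w v =
     (\<Sum>k=1..n. (v k)\<^sup>2 / 2 + W (slope n w k) + \<delta> * (w k * v k + \<epsilon> / 2 * (slope n w k)\<^sup>2))"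

text \<open>
  The correction is at most half of the lower bound \<open>N / 2 + m / 2 * S\<close> of the energy: the product
  \<open>w k * v k\<close> is split by the inequality of the means, and the Poincare inequality turns the squared
  displacements into squared strains.
\<close>

lemma chain_energy_bounds:
  fixes w v :: "nat \<Rightarrow> real"
  assumes "w 0 = 0" and \<delta>: "\<bar>\<delta>\<bar> \<le> 1 / 2" "\<bar>\<delta>\<bar> * (1 + \<bar>\<epsilon>\<bar>) \<le> m / 2" and "0 \<le> m" "m \<le> M"
    and W: "\<And>k. k \<in> {1..n} \<Longrightarrow> m / 2 * (slope n w k)\<^sup>2 \<le> W (slope n w k)"
           "\<And>k. k \<in> {1..n} \<Longrightarrow> W (slope n w k) \<le> M / 2 * (slope n w k)\<^sup>2"
  defines "N \<equiv> (\<Sum>k=1..n. (v k)\<^sup>2)" and "S \<equiv> (\<Sum>k=1..n. (slope n w k)\<^sup>2)"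
  shows "N / 4 + m / 4 * S \<le> chain_energy W \<epsilon> \<delta> n w v"
    and "chain_energy W \<epsilon> \<delta> n w v \<le> (1 + M) * (N + S)"
proof -
  define Q where "Q = (\<Sum>k=1..n. (w k)\<^sup>2)"
  define U where "U = (\<Sum>k=1..n. W (slope n w k))"
  define R where "R = (\<Sum>k=1..n. \<delta> * (w k * v k + \<epsilon> / 2 * (slope n w k)\<^sup>2))"
  have "Q \<le> S" unfolding Q_def S_def using \<open>w 0 = 0\<close> by (rule discrete_poincare)
  have N: "N \<ge> 0" and S: "S \<ge> 0" by (auto simp: N_def S_def intro: sum_nonneg)
  have E: "chain_energy W \<epsilon> \<delta> n w v = N / 2 + U + R"
    by (simp add: chain_energy_def N_def U_def R_def sum.distrib sum_divide_distrib)
  have U: "m / 2 * S \<le> U" "U \<le> M / 2 * S"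
    unfolding U_def S_def sum_distrib_left using W by (auto intro: sum_mono)
  have "\<bar>w k * v k + \<epsilon> / 2 * (slope n w k)\<^sup>2\<bar> \<le> (w k)\<^sup>2 / 2 + (v k)\<^sup>2 / 2 + \<bar>\<epsilon>\<bar> / 2 * (slope n w k)\<^sup>2" for k
  proof -
    have "\<bar>w k * v k\<bar> \<le> (w k)\<^sup>2 / 2 + (v k)\<^sup>2 / 2"
      using zero_le_power2[of "\<bar>w k\<bar> - \<bar>v k\<bar>"] by (simp add: power2_diff abs_mult)
    moreover have "\<bar>\<epsilon> / 2 * (slope n w k)\<^sup>2\<bar> = \<bar>\<epsilon>\<bar> / 2 * (slope n w k)\<^sup>2"
      by (simp add: abs_mult)
    ultimately show ?thesis by linarith
  qed
  then have "\<bar>R\<bar> \<le> (\<Sum>k=1..n. \<bar>\<delta>\<bar> * ((w k)\<^sup>2 / 2 + (v k)\<^sup>2 / 2 + \<bar>\<epsilon>\<bar> / 2 * (slope n w k)\<^sup>2))"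
    unfolding R_def by (intro order.trans[OF sum_abs] sum_mono) (simp add: abs_mult mult_left_mono)
  also have "\<dots> = \<bar>\<delta>\<bar> * (Q / 2 + N / 2 + \<bar>\<epsilon>\<bar> / 2 * S)"
    by (simp add: Q_def N_def S_def sum_distrib_left sum.distrib sum_divide_distrib distrib_left)
  also have "\<dots> \<le> \<bar>\<delta>\<bar> * (S / 2 + N / 2 + \<bar>\<epsilon>\<bar> / 2 * S)"
    using \<open>Q \<le> S\<close> by (intro mult_left_mono) auto
  also have "\<dots> = \<bar>\<delta>\<bar> * N / 2 + \<bar>\<delta>\<bar> * (1 + \<bar>\<epsilon>\<bar>) * S / 2"
    by (simp add: field_simps)
  also have "\<dots> \<le> 1 / 2 * N / 2 + m / 2 * S / 2"
    using \<delta> N S by (intro add_mono divide_right_mono mult_right_mono) auto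
  finally have R: "\<bar>R\<bar> \<le> N / 4 + m / 4 * S" by simp
  show "N / 4 + m / 4 * S \<le> chain_energy W \<epsilon> \<delta> n w v"
    using R U(1) unfolding E by linarith
  have "m * S \<le> M * S" "0 \<le> m * S" "0 \<le> M * N"
    using \<open>0 \<le> m\<close> \<open>m \<le> M\<close> N S by (auto intro: mult_right_mono)
  then show "chain_energy W \<epsilon> \<delta> n w v \<le> (1 + M) * (N + S)"
    using R U(2) N S unfolding E by (simp add: algebra_simps)
qed

text \<open>
  Both \<open>v k\<close> and \<open>w k\<close> are multiplied by the acceleration, a difference quotient of forces; summation by parts
  moves the difference onto them. The elastic part of the power \<open>- q k * g k\<close> cancels the derivative
  of the stored energy, and \<open>\<epsilon> * s k * g k\<close>, the derivative of \<open>\<epsilon> / 2 * (s k)\<^sup>2\<close>, cancels the viscous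
  part of \<open>- q k * s k\<close>.
\<close>

lemma chain_energy_derivative:
  fixes x :: "real \<Rightarrow> nat + nat \<Rightarrow> real" and n :: nat and P :: real
  defines "w \<equiv> \<lambda>s. displacement n P (x s)" and "v \<equiv> \<lambda>s. velocity n (x s)"
  assumes "n \<ge> 1"
    and sol: "\<And>i. i \<in> chain_index n \<Longrightarrow>
      ((\<lambda>s. x s i) has_real_derivative chain_field \<sigma> \<epsilon> n P (x t) i) (at t within J)"
    and W: "\<And>k. k \<in> {1..n} \<Longrightarrow> (W has_real_derivative
      \<sigma> (P + slope n (w t) k) - \<sigma> P) (at (slope n (w t) k))"
  shows "((\<lambda>s. chain_energy W \<epsilon> \<delta> n (w s) (v s)) has_real_derivative
     - \<epsilon> * (\<Sum>k=1..n. (slope n (v t) k)\<^sup>2) + \<delta> * (\<Sum>k=1..n. (v t k)\<^sup>2)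
     - \<delta> * (\<Sum>k=1..n. slope n (w t) k * (\<sigma> (P + slope n (w t) k) - \<sigma> P))) (at t within J)"
proof -
  define q where "q = excess_stress \<sigma> \<epsilon> n P (w t) (v t)"
  \<comment> \<open>The accelerations; the end points are at rest.\<close>
  define A where "A k = (if k = 0 \<or> k = n then 0 else real n * (q (k + 1) - q k))" for k
  define s where "s = slope n (w t)"
  define g where "g = slope n (v t)"
  define \<tau> where "\<tau> k = \<sigma> (P + s k) - \<sigma> P" for k
  have dw: "((\<lambda>s. w s k) has_real_derivative v t k) (at t within J)" if "k \<le> n" for k
  proof (cases "k = 0 \<or> k = n")
    case True
    then show ?thesis
      using displacement_ends[OF \<open>n \<ge> 1\<close>] velocity_ends by (auto simp: w_def v_def)
  next
    case False
    with that have "Inl k \<in> chain_index n" by (auto simp: chain_index_def)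
    from sol[OF this] False show ?thesis
      by (auto simp: w_def v_def chain_field_Inl displacement_def with_ends_def intro!: derivative_eq_intros)
  qed
  have dv: "((\<lambda>s. v s k) has_real_derivative A k) (at t within J)" if "k \<le> n" for k
  proof (cases "k = 0 \<or> k = n")
    case True
    then show ?thesis using velocity_ends by (auto simp: v_def A_def)
  next
    case False
    with that have k: "k \<in> {1..n - 1}" by auto
    then have "Inr k \<in> chain_index n" by (auto simp: chain_index_def)
    from sol[OF this] False k show ?thesis
      unfolding chain_field_Inr[OF k]
      by (simp add: v_def w_def A_def q_def velocity_def[abs_def] with_ends_def)
  qed
  have ds: "((\<lambda>s. slope n (w s) k) has_real_derivative g k) (at t within J)" if "k \<le> n" for k
    unfolding slope_def g_def using that by (intro derivative_intros dw DERIV_cmult) auto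
  have dW: "((\<lambda>s. W (slope n (w s) k)) has_real_derivative \<tau> k * g k) (at t within J)"
    if "k \<in> {1..n}" for k
    using DERIV_chain2[OF W[OF that] ds[of k]] that by (simp add: \<tau>_def s_def)
  have by_parts: "(\<Sum>k=1..n. f k * A k) = - (\<Sum>k=1..n. (\<tau> k + \<epsilon> * g k) * slope n f k)"
    if "f 0 = 0" "f n = 0" for f
  proof -
    have "(\<Sum>k=1..n. f k * A k) = (\<Sum>k=1..n-1. f k * A k)"
      using \<open>n \<ge> 1\<close> \<open>f n = 0\<close> by (cases n) auto
    also have "\<dots> = (\<Sum>k=1..n-1. f k * (real n * (q (k + 1) - q k)))"
      by (intro sum.cong) (auto simp: A_def)
    also have "\<dots> = - (\<Sum>k=1..n. q k * slope n f k)"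
      using \<open>n \<ge> 1\<close> that by (rule sum_slope_by_parts)
    finally show ?thesis by (simp add: q_def excess_stress_def \<tau>_def s_def g_def)
  qed
  have "((\<lambda>s. chain_energy W \<epsilon> \<delta> n (w s) (v s)) has_real_derivative
     (\<Sum>k=1..n. v t k * A k + \<tau> k * g k + \<delta> * (v t k * v t k + w t k * A k + \<epsilon> * s k * g k))) (at t within J)"
    unfolding chain_energy_def
  proof (rule DERIV_sum)
    fix k assume k: "k \<in> {1..n}"
    then have "k \<le> n" by simp
    note d = dw[OF this] dv[OF this] ds[OF this]
    have kinetic: "((\<lambda>s. (v s k)\<^sup>2 / 2) has_real_derivative v t k * A k) (at t within J)"
      using d(2) by (auto intro!: derivative_eq_intros)
    have cross: "((\<lambda>s. \<delta> * (w s k * v s k + \<epsilon> / 2 * (slope n (w s) k)\<^sup>2)) has_real_derivative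
        \<delta> * (v t k * v t k + w t k * A k + \<epsilon> * s k * g k)) (at t within J)"
      using d by (auto intro!: derivative_eq_intros simp: s_def algebra_simps)
    show "((\<lambda>s. (v s k)\<^sup>2 / 2 + W (slope n (w s) k) + \<delta> * (w s k * v s k + \<epsilon> / 2 * (slope n (w s) k)\<^sup>2))
        has_real_derivative v t k * A k + \<tau> k * g k + \<delta> * (v t k * v t k + w t k * A k + \<epsilon> * s k * g k)) (at t within J)"
      by (rule DERIV_add[OF DERIV_add[OF kinetic dW[OF k]] cross])
  qed
  also have "(\<Sum>k=1..n. v t k * A k + \<tau> k * g k + \<delta> * (v t k * v t k + w t k * A k + \<epsilon> * s k * g k))
     = (\<Sum>k=1..n. v t k * A k) + (\<Sum>k=1..n. \<tau> k * g k) + \<delta> * ((\<Sum>k=1..n. (v t k)\<^sup>2)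
         + (\<Sum>k=1..n. w t k * A k) + (\<Sum>k=1..n. \<epsilon> * s k * g k))"
    by (simp add: sum.distrib sum_distrib_left distrib_left power2_eq_square)
  also have "(\<Sum>k=1..n. v t k * A k) = - (\<Sum>k=1..n. (\<tau> k + \<epsilon> * g k) * g k)"
    unfolding g_def using velocity_ends by (subst by_parts) (auto simp: v_def g_def)
  also have "(\<Sum>k=1..n. w t k * A k) = - (\<Sum>k=1..n. (\<tau> k + \<epsilon> * g k) * s k)"
    unfolding s_def using displacement_ends[OF \<open>n \<ge> 1\<close>] by (subst by_parts) (auto simp: w_def s_def)
  also have "- (\<Sum>k=1..n. (\<tau> k + \<epsilon> * g k) * g k) + (\<Sum>k=1..n. \<tau> k * g k)
       + \<delta> * ((\<Sum>k=1..n. (v t k)\<^sup>2) + - (\<Sum>k=1..n. (\<tau> k + \<epsilon> * g k) * s k) + (\<Sum>k=1..n. \<epsilon> * s k * g k))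
     = - \<epsilon> * (\<Sum>k=1..n. (g k)\<^sup>2) + \<delta> * (\<Sum>k=1..n. (v t k)\<^sup>2) - \<delta> * (\<Sum>k=1..n. s k * \<tau> k)"
    by (simp add: distrib_right sum.distrib sum_negf sum_distrib_left power2_eq_square algebra_simps)
  finally show ?thesis by (simp add: s_def g_def \<tau>_def)
qed

text \<open>
  Taking \<open>\<delta>\<close> with the sign of \<open>\<epsilon>\<close> makes all three sums in the derivative of the corrected energy
  proportional to \<open>sgn \<epsilon>\<close>, so the two signs of \<open>\<epsilon>\<close> are mirror images: the corrected energy decays
  exponentially for \<open>\<epsilon> > 0\<close> and grows exponentially for \<open>\<epsilon> < 0\<close>.
\<close>

lemma chain_lyapunov_function:
  fixes \<sigma> :: "real \<Rightarrow> real"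
  assumes "n \<ge> 1" "\<epsilon> \<noteq> 0" "\<rho> > 0" "m > 0" "m \<le> M"
    and monotone: "\<And>s. \<bar>s\<bar> \<le> \<rho> \<Longrightarrow> m * s\<^sup>2 \<le> s * (\<sigma> (P + s) - \<sigma> P)"
    and W: "\<And>s. \<bar>s\<bar> \<le> \<rho> \<Longrightarrow> (W has_real_derivative \<sigma> (P + s) - \<sigma> P) (at s)"
    and W_lower: "\<And>s. \<bar>s\<bar> \<le> \<rho> \<Longrightarrow> m / 2 * s\<^sup>2 \<le> W s"
    and W_upper: "\<And>s. \<bar>s\<bar> \<le> \<rho> \<Longrightarrow> W s \<le> M / 2 * s\<^sup>2"
  obtains V a b c where "a > 0" "a \<le> b" "c > 0"
    and "\<And>y. state_dist (chain_index n) y (uniphase n P) < \<rho> / (2 * real n) \<Longrightarrow>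
           a * (state_dist (chain_index n) y (uniphase n P))\<^sup>2 \<le> V y \<and>
           V y \<le> b * (state_dist (chain_index n) y (uniphase n P))\<^sup>2"
    and "\<And>x J t. state_dist (chain_index n) (x t) (uniphase n P) < \<rho> / (2 * real n) \<Longrightarrow>
           (\<And>i. i \<in> chain_index n \<Longrightarrow>
             ((\<lambda>s. x s i) has_real_derivative chain_field \<sigma> \<epsilon> n P (x t) i) (at t within J)) \<Longrightarrow>
           \<exists>D. ((\<lambda>s. V (x s)) has_real_derivative D) (at t within J) \<and> c * V (x t) \<le> - sgn \<epsilon> * D"
proof -
  \<comment> \<open>The first two bounds keep the energy positive definite. The third one leaves half of the viscous
    term after absorbing \<open>\<delta> * (\<Sum>k. (v k)\<^sup>2)\<close>.\<close>
  define \<delta>\<^sub>0 where "\<delta>\<^sub>0 = min (1 / 2) (min (m / (2 * (1 + \<bar>\<epsilon>\<bar>))) (\<bar>\<epsilon>\<bar> / 2))"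
  have "\<delta>\<^sub>0 > 0"
    using \<open>m > 0\<close> \<open>\<epsilon> \<noteq> 0\<close> by (simp add: \<delta>\<^sub>0_def add_pos_nonneg)
  moreover have "\<delta>\<^sub>0 \<le> 1 / 2" "\<delta>\<^sub>0 \<le> m / (2 * (1 + \<bar>\<epsilon>\<bar>))" "\<delta>\<^sub>0 \<le> \<bar>\<epsilon>\<bar> / 2"
    unfolding \<delta>\<^sub>0_def by linarith+
  ultimately have \<delta>\<^sub>0: "\<delta>\<^sub>0 > 0" "\<delta>\<^sub>0 \<le> 1 / 2" "\<delta>\<^sub>0 \<le> m / (2 * (1 + \<bar>\<epsilon>\<bar>))" "\<delta>\<^sub>0 \<le> \<bar>\<epsilon>\<bar> / 2"
    by auto
  define \<delta> where "\<delta> = sgn \<epsilon> * \<delta>\<^sub>0"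
  have "\<bar>\<delta>\<bar> = \<delta>\<^sub>0" using \<delta>\<^sub>0(1) \<open>\<epsilon> \<noteq> 0\<close> by (simp add: \<delta>_def abs_mult)
  then have \<delta>: "\<bar>\<delta>\<bar> \<le> 1 / 2" "\<bar>\<delta>\<bar> * (1 + \<bar>\<epsilon>\<bar>) \<le> m / 2"
    using \<delta>\<^sub>0 by (auto simp: field_simps)
  define V where "V x = chain_energy W \<epsilon> \<delta> n (displacement n P x) (velocity n x)" for x
  define N where "N x = (\<Sum>k=1..n. (velocity n x k)\<^sup>2)" for x
  define S where "S x = (\<Sum>k=1..n. (slope n (displacement n P x) k)\<^sup>2)" for x
  define Q where "Q x = (\<Sum>k=1..n. (displacement n P x k)\<^sup>2)" for x
  define a where "a = min 1 m / 4"
  define b where "b = (1 + M) * (4 * (real n)\<^sup>2)"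
  define \<kappa> where "\<kappa> = min (\<bar>\<epsilon>\<bar> / 2) (\<delta>\<^sub>0 * m)"
  define c where "c = \<kappa> / (1 + M)"
  have pos: "a > 0" "\<kappa> > 0" "c > 0"
    using \<open>m > 0\<close> \<open>m \<le> M\<close> \<delta>\<^sub>0(1) \<open>\<epsilon> \<noteq> 0\<close> by (auto simp: a_def \<kappa>_def c_def)
  have n1: "(real n)\<^sup>2 \<ge> 1" using \<open>n \<ge> 1\<close> by simp
  have nonneg: "N x \<ge> 0" "S x \<ge> 0" for x by (auto simp: N_def S_def intro: sum_nonneg)
  have QS: "Q x \<le> S x" "S x \<le> 4 * (real n)\<^sup>2 * Q x" for x
    unfolding Q_def S_def
    by (rule discrete_poincare slope_sum_squares_le, rule displacement_ends(1)[OF \<open>n \<ge> 1\<close>])+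
  have dist_sq: "(state_dist (chain_index n) x (uniphase n P))\<^sup>2 = Q x + N x" for x
    unfolding Q_def N_def using \<open>n \<ge> 1\<close> by (rule state_dist_uniphase_sq)
  have near: "\<bar>slope n (displacement n P y) k\<bar> \<le> \<rho>"
    if "state_dist (chain_index n) y (uniphase n P) < \<rho> / (2 * real n)" "k \<in> {1..n}" for y k
  proof (rule slope_displacement_le[OF \<open>n \<ge> 1\<close>])
    show "\<forall>i\<in>chain_index n. \<bar>y i - uniphase n P i\<bar> \<le> \<rho> / (2 * real n)"
      using abs_coord_le_state_dist[OF finite_chain_index, of _ n y "uniphase n P"] that(1) by force
  qed (use that \<open>\<rho> > 0\<close> in auto)
  have V: "N y / 4 + m / 4 * S y \<le> V y" "V y \<le> (1 + M) * (N y + S y)"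
    if "state_dist (chain_index n) y (uniphase n P) < \<rho> / (2 * real n)" for y
    unfolding V_def N_def S_def
    by (rule chain_energy_bounds[where M = M and m = m];
        (rule displacement_ends(1)[OF \<open>n \<ge> 1\<close>] \<delta> less_imp_le[OF \<open>m > 0\<close>] \<open>m \<le> M\<close>
          W_lower[OF near[OF that]] W_upper[OF near[OF that]]; assumption?))+
  show thesis
  proof (rule that)
    show "a > 0" "c > 0" by (fact pos)+
    show "a \<le> b"
    proof -
      have "a \<le> 1 * (4 * 1)" by (simp add: a_def)
      also have "\<dots> \<le> b"
        unfolding b_def using n1 \<open>m > 0\<close> \<open>m \<le> M\<close> by (intro mult_mono) auto
      finally show ?thesis .
    qed
  next
    fix y assume y: "state_dist (chain_index n) y (uniphase n P) < \<rho> / (2 * real n)"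
    have "a * (Q y + N y) \<le> a * (S y + N y)"
      using QS(1)[of y] pos(1) by (intro mult_left_mono) auto
    also have "\<dots> = a * S y + a * N y" by (rule distrib_left)
    also have "\<dots> \<le> m / 4 * S y + 1 / 4 * N y"
      using nonneg[of y] by (intro add_mono mult_right_mono) (auto simp: a_def)
    also have "\<dots> \<le> V y" using V(1)[OF y] by simp
    finally have lower: "a * (Q y + N y) \<le> V y" .
    have "1 * N y \<le> 4 * (real n)\<^sup>2 * N y"
      using n1 nonneg(1)[of y] by (intro mult_right_mono) auto
    then have "N y + S y \<le> 4 * (real n)\<^sup>2 * (Q y + N y)"
      using QS(2)[of y] by (simp add: distrib_left)
    then have "(1 + M) * (N y + S y) \<le> (1 + M) * (4 * (real n)\<^sup>2 * (Q y + N y))"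
      using \<open>m > 0\<close> \<open>m \<le> M\<close> by (intro mult_left_mono) auto
    then have "V y \<le> b * (Q y + N y)"
      using V(2)[OF y] by (simp add: b_def mult.assoc)
    with lower show "a * (state_dist (chain_index n) y (uniphase n P))\<^sup>2 \<le> V y \<and>
           V y \<le> b * (state_dist (chain_index n) y (uniphase n P))\<^sup>2"
      by (simp add: dist_sq)
  next
    fix x :: "real \<Rightarrow> nat + nat \<Rightarrow> real" and J t
    assume x: "state_dist (chain_index n) (x t) (uniphase n P) < \<rho> / (2 * real n)"
      and sol: "\<And>i. i \<in> chain_index n \<Longrightarrow>
             ((\<lambda>s. x s i) has_real_derivative chain_field \<sigma> \<epsilon> n P (x t) i) (at t within J)"
    define G where "G = (\<Sum>k=1..n. (slope n (velocity n (x t)) k)\<^sup>2)"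
    define T where "T = (\<Sum>k=1..n. slope n (displacement n P (x t)) k *
      (\<sigma> (P + slope n (displacement n P (x t)) k) - \<sigma> P))"
    define D where "D = - \<epsilon> * G + \<delta> * N (x t) - \<delta> * T"
    have deriv: "((\<lambda>s. V (x s)) has_real_derivative D) (at t within J)"
      unfolding V_def D_def G_def T_def N_def
      using \<open>n \<ge> 1\<close> sol W near[OF x] by (intro chain_energy_derivative) auto
    have "N (x t) \<le> G"
      unfolding N_def G_def using velocity_ends(1) by (rule discrete_poincare)
    have "m * S (x t) \<le> T"
      unfolding S_def T_def sum_distrib_left using near[OF x] monotone by (intro sum_mono) auto
    have sgn: "sgn \<epsilon> * \<epsilon> = \<bar>\<epsilon>\<bar>" "sgn \<epsilon> * \<delta> = \<delta>\<^sub>0"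
      using \<open>\<epsilon> \<noteq> 0\<close> by (auto simp: \<delta>_def sgn_if)
    have "- sgn \<epsilon> * D = (sgn \<epsilon> * \<epsilon>) * G - (sgn \<epsilon> * \<delta>) * N (x t) + (sgn \<epsilon> * \<delta>) * T"
      by (simp add: D_def algebra_simps)
    also have "\<dots> = \<bar>\<epsilon>\<bar> * G - \<delta>\<^sub>0 * N (x t) + \<delta>\<^sub>0 * T"
      unfolding sgn ..
    finally have D: "- sgn \<epsilon> * D = \<bar>\<epsilon>\<bar> * G - \<delta>\<^sub>0 * N (x t) + \<delta>\<^sub>0 * T" .
    have "c * V (x t) \<le> c * ((1 + M) * (N (x t) + S (x t)))"
      using V(2)[OF x] pos(3) by (intro mult_left_mono) auto
    also have "\<dots> = \<kappa> * N (x t) + \<kappa> * S (x t)"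
      using \<open>m > 0\<close> \<open>m \<le> M\<close> by (simp add: c_def distrib_left)
    also have "\<dots> \<le> \<bar>\<epsilon>\<bar> / 2 * N (x t) + \<delta>\<^sub>0 * m * S (x t)"
      using nonneg[of "x t"] by (intro add_mono mult_right_mono) (auto simp: \<kappa>_def)
    also have "\<dots> \<le> - sgn \<epsilon> * D"
    proof -
      have "\<bar>\<epsilon>\<bar> * N (x t) \<le> \<bar>\<epsilon>\<bar> * G" "\<delta>\<^sub>0 * (m * S (x t)) \<le> \<delta>\<^sub>0 * T"
        using \<open>N (x t) \<le> G\<close> \<open>m * S (x t) \<le> T\<close> \<delta>\<^sub>0(1) by (auto intro: mult_left_mono)
      moreover have "\<delta>\<^sub>0 * N (x t) \<le> \<bar>\<epsilon>\<bar> / 2 * N (x t)"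
        using \<delta>\<^sub>0(4) nonneg(1) by (rule mult_right_mono)
      ultimately show ?thesis unfolding D by (simp add: mult.assoc)
    qed
    finally show "\<exists>D. ((\<lambda>s. V (x s)) has_real_derivative D) (at t within J) \<and> c * V (x t) \<le> - sgn \<epsilon> * D"
      using deriv by blast
  qed
qed

section \<open>Stability and instability of the uniphase state\<close>

theorem theorem3p1:
  fixes \<sigma> \<sigma>' :: "real \<Rightarrow> real"
    and P \<epsilon> \<alpha>\<^sub>l \<alpha>\<^sub>u \<beta>\<^sub>l \<beta>\<^sub>u :: real
    and n :: nat
  assumes "P > 0"
    and "n \<ge> 2"
    and "\<And>\<xi>. (\<sigma> has_real_derivative \<sigma>' \<xi>) (at \<xi>)"
    and "continuous_on UNIV \<sigma>'"
    and "\<sigma> 0 = 0"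
    and "\<And>\<xi>. \<xi> > 0 \<Longrightarrow> \<sigma> \<xi> > 0"
    and "\<And>\<xi>. \<xi> < 0 \<Longrightarrow> \<sigma> \<xi> < 0"
    and "0 < \<alpha>\<^sub>l" and "\<alpha>\<^sub>l < \<alpha>\<^sub>u" and "\<alpha>\<^sub>u < \<beta>\<^sub>l" and "\<beta>\<^sub>l < \<beta>\<^sub>u"
    and "\<And>\<xi>. \<xi> \<in> {..<\<alpha>\<^sub>u} \<union> {\<beta>\<^sub>l<..} \<Longrightarrow> \<sigma>' \<xi> > 0"
    and "\<And>\<xi>. \<xi> \<in> {\<alpha>\<^sub>u<..<\<beta>\<^sub>l} \<Longrightarrow> \<sigma>' \<xi> < 0"
    and "\<sigma> \<alpha>\<^sub>l = \<sigma> \<beta>\<^sub>l"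
    and "\<sigma> \<alpha>\<^sub>u = \<sigma> \<beta>\<^sub>u"
    and "P \<in> {\<alpha>\<^sub>l<..<\<alpha>\<^sub>u} \<or> P \<in> {\<beta>\<^sub>l<..<\<beta>\<^sub>u}"
  shows "(\<epsilon> > 0 \<longrightarrow> asymptotically_stable (chain_index n) (chain_field \<sigma> \<epsilon> n P) (uniphase n P)) \<and>
         (\<epsilon> < 0 \<longrightarrow> unstable (chain_index n) (chain_field \<sigma> \<epsilon> n P) (uniphase n P))"
proof -
  have "P < \<alpha>\<^sub>u \<or> P > \<beta>\<^sub>l" using assms(16) by auto
  then have "\<sigma>' P > 0" using assms(12)[of P] by auto
  from stored_energy_near_increasing_point[OF assms(3,4) this]
  obtain \<rho> m M W where "\<rho> > 0" "m > 0" "m \<le> M"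
    and lip: "\<And>\<xi> \<eta>. \<bar>\<xi> - P\<bar> \<le> \<rho> \<Longrightarrow> \<bar>\<eta> - P\<bar> \<le> \<rho> \<Longrightarrow> \<bar>\<sigma> \<xi> - \<sigma> \<eta>\<bar> \<le> M * \<bar>\<xi> - \<eta>\<bar>"
    and monotone: "\<And>s. \<bar>s\<bar> \<le> \<rho> \<Longrightarrow> m * s\<^sup>2 \<le> s * (\<sigma> (P + s) - \<sigma> P)"
    and W: "\<And>s. \<bar>s\<bar> \<le> \<rho> \<Longrightarrow> (W has_real_derivative \<sigma> (P + s) - \<sigma> P) (at s)"
      "\<And>s. \<bar>s\<bar> \<le> \<rho> \<Longrightarrow> m / 2 * s\<^sup>2 \<le> W s" "\<And>s. \<bar>s\<bar> \<le> \<rho> \<Longrightarrow> W s \<le> M / 2 * s\<^sup>2"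
    by blast
  have "n \<ge> 1" using \<open>n \<ge> 2\<close> by simp
  define r where "r = \<rho> / (2 * real n)"
  have "r > 0" using \<open>\<rho> > 0\<close> \<open>n \<ge> 1\<close> by (simp add: r_def)
  let ?I = "chain_index n" and ?F = "chain_field \<sigma> \<epsilon> n P" and ?z = "uniphase n P"
  have "Inl 1 \<in> ?I" using \<open>n \<ge> 2\<close> by (auto simp: chain_index_def)
  then have "?I \<noteq> {}" by blast
  show ?thesis
  proof (cases "\<epsilon> = 0")
    case False
    show ?thesis
    proof (rule chain_lyapunov_function[OF \<open>n \<ge> 1\<close> False \<open>\<rho> > 0\<close> \<open>m > 0\<close> \<open>m \<le> M\<close> monotone W, folded r_def])
      fix V a b c
      assume "a > 0" "a \<le> b" "c > 0"
        and quad: "\<And>y. state_dist ?I y ?z < r \<Longrightarrow>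
           a * (state_dist ?I y ?z)\<^sup>2 \<le> V y \<and> V y \<le> b * (state_dist ?I y ?z)\<^sup>2"
        and rate: "\<And>x J t. state_dist ?I (x t) ?z < r \<Longrightarrow>
           (\<And>i. i \<in> ?I \<Longrightarrow> ((\<lambda>s. x s i) has_real_derivative ?F (x t) i) (at t within J)) \<Longrightarrow>
           \<exists>D. ((\<lambda>s. V (x s)) has_real_derivative D) (at t within J) \<and> c * V (x t) \<le> - sgn \<epsilon> * D"
      show ?thesis
      proof (intro conjI impI)
        assume "\<epsilon> > 0"
        have decay: "\<exists>D. ((\<lambda>s. V (x s)) has_real_derivative D) (at t within J) \<and> D \<le> - c * V (x t)"
          if "state_dist ?I (x t) ?z < r"
            "\<And>i. i \<in> ?I \<Longrightarrow> ((\<lambda>s. x s i) has_real_derivative ?F (x t) i) (at t within J)" for x J t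
          using rate[OF that] \<open>\<epsilon> > 0\<close> by auto
        show "asymptotically_stable ?I ?F ?z"
        proof (rule asymptotically_stable_of_quadratic_lyapunov[OF finite_chain_index _ \<open>r > 0\<close> \<open>a > 0\<close> \<open>a \<le> b\<close> \<open>c > 0\<close>])
          show "0 \<le> 1 + 4 * (real n)\<^sup>2 * (M + \<bar>\<epsilon>\<bar>)" using \<open>m > 0\<close> \<open>m \<le> M\<close> by simp
          show "\<bar>?F x i - ?F y i\<bar> \<le> (1 + 4 * (real n)\<^sup>2 * (M + \<bar>\<epsilon>\<bar>)) * state_dist ?I x y"
            if "i \<in> ?I" "\<forall>j\<in>?I. \<bar>x j - ?z j\<bar> \<le> r" "\<forall>j\<in>?I. \<bar>y j - ?z j\<bar> \<le> r" for x y i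
            using chain_field_lipschitz[where \<rho> = \<rho> and P = P and M = M, OF \<open>n \<ge> 1\<close> _ _ lip]
              that \<open>\<rho> > 0\<close> \<open>m > 0\<close> \<open>m \<le> M\<close> by (simp add: r_def)
        qed (fact quad decay)+
      next
        assume "\<epsilon> < 0"
        have growth: "\<exists>D. ((\<lambda>s. V (x s)) has_real_derivative D) (at t within J) \<and> D \<ge> c * V (x t)"
          if "state_dist ?I (x t) ?z < r"
            "\<And>i. i \<in> ?I \<Longrightarrow> ((\<lambda>s. x s i) has_real_derivative ?F (x t) i) (at t within J)" for x J t
          using rate[OF that] \<open>\<epsilon> < 0\<close> by auto
        show "unstable ?I ?F ?z"
          by (rule unstable_of_quadratic_growth[OF finite_chain_index \<open>?I \<noteq> {}\<close> \<open>r > 0\<close> \<open>a > 0\<close> \<open>c > 0\<close>])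
             (fact quad growth)+
      qed
    qed
  qed simp
qed

end
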